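(* Let $\mathbb{M}$ be an implicitization matrix of $\phi$ (a $d\times d$ matrix), and let $\mathbb{M}^*$ be the $d\times(d-1)$ sub-matrix obtained by erasing the first column of $\mathbb{M}$ (the column corresponding to $P$). Then the gcd of the maximal minors of $\mathbb{M}^*$ equals $F^p$ (up to a nonzero constant) for some $p\in\mathbb{N}$. Moreover the following are equivalent: (1) $\phi$ is birational; (2) $p=0$; (3) $\mathbb{M}^*$ is an inversion matrix of $\phi$.
   Context: $\mathbb{K}$ is a field of characteristic zero. $\phi:\mathbb{P}^2\dashrightarrow\mathbb{P}^3$, $\mathbf{t}=(t_1:t_2:t_3)\mapsto (p_1(\mathbf{t}):\dots:p_4(\mathbf{t}))$, with $p_i\in\mathbb{K}[t_1,t_2,t_3]$ homogeneous of the same degree, $\phi$ generically finite, so the closure of its image is an irreducible surface $S\subset\mathbb{P}^3$. $F\in\mathbb{K}[X_1,\dots,X_4]$ is the implicit equation of $S$ (irreducible homogeneous of minimal degree with $F(p_1,\dots,p_4)\equiv0$, defined up to a nonzero constant). $\mathbb{K}(S)$, $\mathbb{K}(\mathbb{P}^2)$ are the rational function fields (rank over $\mathbb{K}(S)$ of a matrix over $\mathbb{K}[\underline{X}]$ means rank of its image over the fraction field of $\mathbb{K}[\underline{X}]/(F)$); $\phi^\sharp:\mathbb{K}(S)\to\mathbb{K}(\mathbb{P}^2)$, $f\mapsto f\circ\phi$; $\deg\phi=[\mathbb{K}(\mathbb{P}^2):\mathbb{K}(S)]$; $\phi$ is birational iff $\deg\phi=1$. A moving surface of bi-degree $(m;n)$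 ($m,n\ge1$) is a polynomial bihomogeneous of degree $m$ in $\mathbf{t}=(t_1,t_2,t_3)$ and $n$ in $\underline{X}=(X_1,\dots,X_4)$; it follows $\phi$ if it vanishes identically after substituting $X_i=p_i(\mathbf{t})$. An inversion matrix of $\phi$ is a $d\times(d-1)$ matrix $\mathbb{M}$ with entries in $\mathbb{K}[\underline{X}]$ such that: (i) there exist $m\ge1$ and distinct monomials $\mathbf{t}^{\alpha_1},\dots,\mathbf{t}^{\alpha_d}$ of degree $m$ (indexing the rows) with ${}^t\mathbb{M}(\mathbf{t}^{\alpha_1},\dots,\mathbf{t}^{\alpha_d})^t=(M_1,\dots,M_{d-1})^t$, each $M_i$ a moving surface of bi-degree $(m;d_i)$ following $\phi$, and there exist $\mathbf{t}^{\beta_1},\mathbf{t}^{\beta_2},\mathbf{t}^{\beta_3}$ among the $\mathbf{t}^{\alpha_i}$ with $t_1\mathbf{t}^{\beta_3}=t_3\mathbf{t}^{\beta_1}$ and $t_2\mathbf{t}^{\beta_3}=t_3\mathbf{t}^{\beta_2}$; (ii) the rank of $\mathbb{M}$ over $\mathbb{K}(S)$ is exactly $d-1$. An implicitization matrix of $\phi$ is a square $d\times d$ matrix $\mathbb{M}$ with entries in $\mathbb{K}[\underline{X}]$ such that: (1) there exist $m\ge1$ and distinct monomials $\mathbf{t}^{\alpha_1},\dots,\mathbf{t}^{\alpha_d}$ of degree $m$ (indexing the rows) with ${}^t\mathbb{M}(\mathbf{t}^{\alpha_1},\dots,\mathbf{t}^{\alpha_d})^t=(P(\mathbf{t};\underline{X}),M_1,\dots,M_{d-1})^t$,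 where each $M_i$ is a moving surface of bi-degree $(m;d_i)$ following $\phi$ and $P$ is a bihomogeneous polynomial of positive degree in $\underline{X}$, and there exist $\mathbf{t}^{\beta_1},\mathbf{t}^{\beta_2},\mathbf{t}^{\beta_3}$ among the $\mathbf{t}^{\alpha_i}$ with $t_1\mathbf{t}^{\beta_3}=t_3\mathbf{t}^{\beta_1}$ and $t_2\mathbf{t}^{\beta_3}=t_3\mathbf{t}^{\beta_2}$; (2) $\det(\mathbb{M})=c\,F^\delta$ with $\delta\ge1$ an integer and $c\in\mathbb{K}\setminus\{0\}$; (3) if $\phi$ is birational then $\delta=1$. *)

theory Defs
  imports "HOL-Computational_Algebra.Computational_Algebra" "Jordan_Normal_Form.Determinant"
begin

(* Conventions.
   K[t1,t2,t3] is the type 'k poly poly poly; t1 is the outermost variable, t3 the innermost.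
   K[X1,..,X4] is the type 'k poly poly poly poly; X1 outermost, X4 innermost.
   The parametrization phi is given by p :: nat => K[t], with p 0,..,p 3 = p_1,..,p_4. *)

type_synonym 'k tpoly = "'k poly poly poly"
type_synonym 'k xpoly = "'k poly poly poly poly"

definition coeffT :: "'k::zero tpoly \<Rightarrow> nat \<Rightarrow> nat \<Rightarrow> nat \<Rightarrow> 'k" where
  "coeffT q a b c = coeff (coeff (coeff q a) b) c"

definition coeffX :: "'k::zero xpoly \<Rightarrow> nat \<Rightarrow> nat \<Rightarrow> nat \<Rightarrow> nat \<Rightarrow> 'k" where
  "coeffX q a b c e = coeff (coeff (coeff (coeff q a) b) c) e"

(* homogeneous of degree n (the zero polynomial is homogeneous of every degree) *)
definition homogT :: "nat \<Rightarrow> 'k::zero tpoly \<Rightarrow> bool" where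
  "homogT n q \<longleftrightarrow> (\<forall>a b c. coeffT q a b c \<noteq> 0 \<longrightarrow> a + b + c = n)"

definition homogX :: "nat \<Rightarrow> 'k::zero xpoly \<Rightarrow> bool" where
  "homogX n q \<longleftrightarrow> (\<forall>a b c e. coeffX q a b c e \<noteq> 0 \<longrightarrow> a + b + c + e = n)"

definition constT :: "'k::zero \<Rightarrow> 'k tpoly" where
  "constT c = [:[:[:c:]:]:]"

definition constX :: "'k::zero \<Rightarrow> 'k xpoly" where
  "constX c = [:[:[:[:c:]:]:]:]"

definition t1 :: "'k::comm_semiring_1 tpoly" where "t1 = [:0, 1:]"
definition t2 :: "'k::comm_semiring_1 tpoly" where "t2 = [:[:0, 1:]:]"
definition t3 :: "'k::comm_semiring_1 tpoly" where "t3 = [:[:[:0, 1:]:]:]"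

definition tmon :: "nat \<times> nat \<times> nat \<Rightarrow> 'k::comm_semiring_1 tpoly" where
  "tmon \<alpha> = (case \<alpha> of (a, b, c) \<Rightarrow> t1 ^ a * t2 ^ b * t3 ^ c)"

definition evalX :: "(nat \<Rightarrow> 'k::comm_semiring_1 tpoly) \<Rightarrow> 'k xpoly \<Rightarrow> 'k tpoly" where
  "evalX p q =
     poly (map_poly (\<lambda>q3. poly (map_poly (\<lambda>q2. poly (map_poly (\<lambda>q1.
        poly (map_poly constT q1) (p 3)) q2) (p 2)) q3) (p 1)) q) (p 0)"

definition param :: "(nat \<Rightarrow> 'k::comm_semiring_1 tpoly) \<Rightarrow> bool" where
  "param p \<longleftrightarrow> (\<exists>n. \<forall>i<4. homogT n (p i))"

(* K(P^2) is algebraic (equivalently, being finitely generated, finite) over phi^#(K(S)):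
   every a/b with a, b homogeneous of the same degree, b \<noteq> 0, satisfies a nontrivial
   polynomial relation with coefficients in phi^#(K(S)) (denominators cleared). *)
definition generically_finite :: "(nat \<Rightarrow> 'k::comm_ring_1 tpoly) \<Rightarrow> bool" where
  "generically_finite p \<longleftrightarrow>
     (\<forall>a b n. homogT n a \<and> homogT n b \<and> b \<noteq> 0 \<longrightarrow>
        (\<exists>N e (G :: nat \<Rightarrow> 'k xpoly). (\<forall>k\<le>N. homogX e (G k)) \<and> (\<exists>k\<le>N. evalX p (G k) \<noteq> 0) \<and>
           (\<Sum>k\<le>N. evalX p (G k) * a ^ k * b ^ (N - k)) = 0))"

definition implicit_eq :: "(nat \<Rightarrow> 'k::idom tpoly) \<Rightarrow> 'k xpoly \<Rightarrow> bool" where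
  "implicit_eq p F \<longleftrightarrow> irreducible F \<and> evalX p F = 0 \<and>
     (\<exists>nF. homogX nF F \<and>
        (\<forall>G n. irreducible G \<and> homogX n G \<and> evalX p G = 0 \<longrightarrow> nF \<le> n))"

(* phi birational, i.e. [K(P^2) : K(S)] = 1, i.e. phi^# : K(S) \<rightarrow> K(P^2) is onto:
   every a/b (a, b homogeneous of the same degree, b \<noteq> 0) equals f(p)/g(p)
   with f, g homogeneous of the same degree and g(p) \<noteq> 0. *)
definition birational :: "(nat \<Rightarrow> 'k::comm_ring_1 tpoly) \<Rightarrow> bool" where
  "birational p \<longleftrightarrow>
     (\<forall>a b n. homogT n a \<and> homogT n b \<and> b \<noteq> 0 \<longrightarrow>
        (\<exists>f g e. homogX e f \<and> homogX e g \<and> evalX p g \<noteq> 0 \<and> a * evalX p g = b * evalX p f))"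

definition good_monomials :: "nat \<Rightarrow> nat \<Rightarrow> (nat \<Rightarrow> nat \<times> nat \<times> nat) \<Rightarrow> bool" where
  "good_monomials m d \<alpha> \<longleftrightarrow>
     (\<forall>j<d. (case \<alpha> j of (a, b, c) \<Rightarrow> a + b + c = m)) \<and> inj_on \<alpha> {..<d} \<and>
     (\<exists>j1<d. \<exists>j2<d. \<exists>j3<d.
        (t1 :: rat tpoly) * tmon (\<alpha> j3) = t3 * tmon (\<alpha> j1) \<and>
        (t2 :: rat tpoly) * tmon (\<alpha> j3) = t3 * tmon (\<alpha> j2))"

(* column i of A, read against the row monomials t^(alpha j), is a moving surface of
   bidegree (m; e) following phi *)
definition moving_col :: "(nat \<Rightarrow> 'k::comm_semiring_1 tpoly) \<Rightarrow> nat \<Rightarrow> nat \<Rightarrow> (nat \<Rightarrow> nat \<times> nat \<times> nat)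
                           \<Rightarrow> 'k xpoly mat \<Rightarrow> nat \<Rightarrow> nat \<Rightarrow> bool" where
  "moving_col p m d \<alpha> A i e \<longleftrightarrow> m \<ge> 1 \<and> e \<ge> 1 \<and> (\<forall>j<d. homogX e (A $$ (j, i))) \<and>
     (\<Sum>j<d. evalX p (A $$ (j, i)) * tmon (\<alpha> j)) = 0"

(* rank of A over K(S) = Frac(K[X]/(F)) equals the number of columns:
   the columns are linearly independent over the domain K[X]/(F) *)
definition full_col_rank_mod :: "'k::comm_ring_1 xpoly \<Rightarrow> 'k xpoly mat \<Rightarrow> bool" where
  "full_col_rank_mod F A \<longleftrightarrow>
     (\<forall>c :: nat \<Rightarrow> 'k xpoly.
        (\<forall>i<dim_row A. F dvd (\<Sum>j<dim_col A. c j * A $$ (i, j))) \<longrightarrow> (\<forall>j<dim_col A. F dvd c j))"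

definition inversion_matrix :: "(nat \<Rightarrow> 'k::comm_ring_1 tpoly) \<Rightarrow> 'k xpoly \<Rightarrow> 'k xpoly mat \<Rightarrow> bool" where
  "inversion_matrix p F A \<longleftrightarrow>
     (\<exists>d m \<alpha>. dim_row A = d \<and> dim_col A = d - 1 \<and> m \<ge> 1 \<and> good_monomials m d \<alpha> \<and>
        (\<forall>i<d - 1. \<exists>e. moving_col p m d \<alpha> A i e) \<and>
        full_col_rank_mod F A)"

definition implicitization_matrix :: "(nat \<Rightarrow> 'k::comm_ring_1 tpoly) \<Rightarrow> 'k xpoly \<Rightarrow> 'k xpoly mat \<Rightarrow> bool" where
  "implicitization_matrix p F A \<longleftrightarrow>
     (\<exists>d m \<alpha>. dim_row A = d \<and> dim_col A = d \<and> m \<ge> 1 \<and> good_monomials m d \<alpha> \<and>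
        (\<exists>e0 \<ge> 1. \<forall>j<d. homogX e0 (A $$ (j, 0))) \<and>
        (\<forall>i. 1 \<le> i \<and> i < d \<longrightarrow> (\<exists>e. moving_col p m d \<alpha> A i e)) \<and>
        (\<exists>\<delta> c. \<delta> \<ge> 1 \<and> c \<noteq> 0 \<and> det A = constX c * F ^ \<delta> \<and> (birational p \<longrightarrow> \<delta> = 1)))"

definition erase_first_col :: "'a mat \<Rightarrow> 'a mat" where
  "erase_first_col A = mat (dim_row A) (dim_col A - 1) (\<lambda>(i, j). A $$ (i, Suc j))"

definition delete_row :: "nat \<Rightarrow> 'a mat \<Rightarrow> 'a mat" where
  "delete_row r A = mat (dim_row A - 1) (dim_col A) (\<lambda>(i, j). A $$ (if i < r then i else Suc i, j))"

definition maximal_minors :: "'a::comm_ring_1 mat \<Rightarrow> 'a set" where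
  "maximal_minors A = {det (delete_row r A) | r. r < dim_row A}"

end

theory Submission
  imports Defs
begin

text \<open>
The kernel of \<open>X\<^sub>i \<mapsto> p\<^sub>i\<close> is generated by \<open>F\<close>: if it contained some \<open>G\<close> not divisible by \<open>F\<close>, elimination would
produce a relation between any three of the \<open>p\<^sub>i\<close>, so any three gradients would be linearly dependent
(characteristic zero), and a nonzero derivation of \<open>K[t]\<close> would kill all \<open>p\<^sub>i\<close>. By generic finiteness it kills
\<open>t\<^sub>1/t\<^sub>3\<close> and \<open>t\<^sub>2/t\<^sub>3\<close>, so it is a multiple of the Euler derivation, which does not kill the \<open>p\<^sub>i\<close>.

Expanding \<open>det M = c F\<^sup>\<delta>\<close> along the first column shows that the gcd of the minors of \<open>M\<^sup>*\<close> divides a power of the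
prime \<open>F\<close>. If \<open>\<phi>\<close> is birational then \<open>\<delta> = 1\<close>, and \<open>F\<close> cannot divide all minors, since the entries of the first
column vanish at the origin. If the gcd is trivial, some minor is nonzero modulo \<open>F\<close> and the rank is maximal.
If the rank is maximal, some minor is nonzero on the surface, and the one-dimensional left kernel of \<open>M\<^sup>*\<close> is
spanned both by the signed minors and by the monomials \<open>t\<^sup>\<alpha>\<close>; hence \<open>t\<^sub>1/t\<^sub>3\<close> and \<open>t\<^sub>2/t\<^sub>3\<close> are quotients of minors.
\<close>

subsection \<open>Substitution homomorphisms and elimination\<close>

lemma comm_ring_homI:
  assumes "\<And>x y. h (x + y) = h x + h y" "\<And>x y. h (x * y) = h x * h y" "h 1 = 1"
  shows "comm_ring_hom (h :: 'a::comm_ring_1 \<Rightarrow> 'b::comm_ring_1)"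
proof -
  have "h 0 = 0" using assms(1)[of 0 0] by simp
  then show ?thesis by unfold_locales (use assms in auto)
qed

lemma map_poly_pCons_hom: "h 0 = 0 \<Longrightarrow> map_poly h (pCons a q) = pCons (h a) (map_poly h q)"
  by (auto simp: poly_eq_iff coeff_map_poly coeff_pCons split: nat.splits)

text \<open>Each of the four nested layers of \<open>evalX\<close> has this shape, so four
  applications make the whole substitution a ring homomorphism.\<close>

lemma comm_ring_hom_poly_map_poly:
  fixes h :: "'a::comm_ring_1 \<Rightarrow> 'b::comm_ring_1"
  assumes "comm_ring_hom h"
  shows "comm_ring_hom (\<lambda>q. poly (map_poly h q) x)"
proof -
  interpret h: comm_ring_hom h by fact
  have add: "map_poly h (q + r) = map_poly h q + map_poly h r" for q r
    by (simp add: poly_eq_iff coeff_map_poly h.hom_add)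
  have smult: "map_poly h (Polynomial.smult a q) = Polynomial.smult (h a) (map_poly h q)" for a q
    by (simp add: poly_eq_iff coeff_map_poly h.hom_mult)
  have mult: "map_poly h (q * r) = map_poly h q * map_poly h r" for q r
    by (induction q) (simp_all add: map_poly_pCons_hom add smult)
  have "map_poly h 1 = 1"
    by (simp add: one_pCons map_poly_pCons_hom)
  then show ?thesis
    by (intro comm_ring_homI) (simp_all add: add mult)
qed

lemma poly_ring_induct:
  fixes q :: "'a::comm_ring_1 poly"
  assumes "\<And>a. P [:a:]" "P [:0, 1:]"
    and "\<And>q r. P q \<Longrightarrow> P r \<Longrightarrow> P (q + r)" "\<And>q r. P q \<Longrightarrow> P r \<Longrightarrow> P (q * r)"
  shows "P q"
proof (induction q)
  case 0
  then show ?case using assms(1)[of 0] by simp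
next
  case (pCons a q)
  have "pCons a q = [:a:] + [:0, 1:] * q" by simp
  then show ?case using assms pCons by metis
qed

definition varX :: "nat \<Rightarrow> 'k::comm_ring_1 xpoly" where
  "varX i = (if i = 0 then [:0, 1:] else if i = 1 then [:[:0, 1:]:]
     else if i = 2 then [:[:[:0, 1:]:]:] else [:[:[:[:0, 1:]:]:]:])"

text \<open>Constants and variables generate the ring, one layer of \<open>poly_ring_induct\<close>
  per variable. Identities between homomorphisms or derivations thus need checking only on
  generators.\<close>

lemma xpoly_ring_induct:
  fixes q :: "'k::comm_ring_1 xpoly"
  assumes const: "\<And>c. P (constX c)" and var: "\<And>i. i < 4 \<Longrightarrow> P (varX i)"
    and add: "\<And>q r. P q \<Longrightarrow> P r \<Longrightarrow> P (q + r)" and mult: "\<And>q r. P q \<Longrightarrow> P r \<Longrightarrow> P (q * r)"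
  shows "P q"
proof (induction q rule: poly_ring_induct)
  case (1 a)
  show ?case
  proof (induction a rule: poly_ring_induct)
    case (1 a)
    show ?case
    proof (induction a rule: poly_ring_induct)
      case (1 a)
      show ?case
      proof (induction a rule: poly_ring_induct)
        case (1 a)
        show ?case using const by (simp add: constX_def)
      next
        case 2
        show ?case using var[of 3] by (simp add: varX_def)
      qed (use add mult in fastforce)+
    next
      case 2
      show ?case using var[of 2] by (simp add: varX_def)
    qed (use add mult in fastforce)+
  next
    case 2
    show ?case using var[of 1] by (simp add: varX_def)
  qed (use add mult in fastforce)+
next
  case 2
  show ?case using var[of 0] by (simp add: varX_def)
qed (use add mult in auto)

text \<open>Generalizes \<open>evalX\<close> to any coefficient map and target ring, so that one
  theory covers both the parametrization and the exchange of variables.\<close>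

definition substX :: "('k::comm_ring_1 \<Rightarrow> 'r::comm_ring_1) \<Rightarrow> (nat \<Rightarrow> 'r) \<Rightarrow> 'k xpoly \<Rightarrow> 'r" where
  "substX h v q =
     poly (map_poly (\<lambda>q3. poly (map_poly (\<lambda>q2. poly (map_poly (\<lambda>q1.
        poly (map_poly h q1) (v 3)) q2) (v 2)) q3) (v 1)) q) (v 0)"

lemma evalX_eq_substX: "evalX p = substX constT p"
  by (simp add: fun_eq_iff evalX_def substX_def)

lemma comm_ring_hom_substX:
  assumes "comm_ring_hom h"
  shows "comm_ring_hom (substX h v)"
  unfolding substX_def[abs_def] by (intro comm_ring_hom_poly_map_poly assms)

lemma substX_constX:
  assumes "comm_ring_hom h"
  shows "substX h v (constX c) = h c"
proof -
  interpret h: comm_ring_hom h by fact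
  show ?thesis by (simp add: substX_def constX_def map_poly_pCons_hom)
qed

lemma substX_varX:
  assumes "comm_ring_hom h" "i < 4"
  shows "substX h v (varX i) = v i"
proof -
  interpret h: comm_ring_hom h by fact
  consider "i = 0" | "i = 1" | "i = 2" | "i = 3" using assms(2) by linarith
  then show ?thesis
    by cases (simp_all add: substX_def varX_def map_poly_pCons_hom one_pCons)
qed

lemma comm_ring_hom_constT: "comm_ring_hom constT"
  by (intro comm_ring_homI) (simp_all add: constT_def one_pCons)

lemma comm_ring_hom_evalX: "comm_ring_hom (evalX p)"
  unfolding evalX_eq_substX by (intro comm_ring_hom_substX comm_ring_hom_constT)

lemma comm_ring_hom_constX: "comm_ring_hom constX"
  by (intro comm_ring_homI) (simp_all add: constX_def one_pCons)

text \<open>Brings the variable to be eliminated to the outermost position, where the degree of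
  \<open>poly\<close> measures it.\<close>

definition swapX :: "nat \<Rightarrow> 'k::comm_ring_1 xpoly \<Rightarrow> 'k xpoly" where
  "swapX i = substX constX (\<lambda>j. varX (transpose 0 i j))"

lemma comm_ring_hom_swapX: "comm_ring_hom (swapX i)"
  unfolding swapX_def by (intro comm_ring_hom_substX comm_ring_hom_constX)

lemma swapX_swapX:
  assumes "i < 4"
  shows "swapX i (swapX i q) = q"
proof (induction q rule: xpoly_ring_induct)
  case (1 c)
  show ?case by (simp add: swapX_def substX_constX comm_ring_hom_constX)
next
  case (2 j)
  then have "transpose 0 i j < 4" using assms by (simp add: transpose_def)
  with 2 show ?case by (simp add: swapX_def substX_varX comm_ring_hom_constX)
next
  case (3 q r)
  interpret comm_ring_hom "swapX i" by (rule comm_ring_hom_swapX)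
  show ?case using 3 by (simp add: hom_distribs)
next
  case (4 q r)
  interpret comm_ring_hom "swapX i" by (rule comm_ring_hom_swapX)
  show ?case using 4 by (simp add: hom_distribs)
qed

lemma swapX_dvd_iff: "i < 4 \<Longrightarrow> swapX i a dvd swapX i b \<longleftrightarrow> a dvd b"
proof -
  assume i: "i < 4"
  interpret comm_ring_hom "swapX i" by (rule comm_ring_hom_swapX)
  show ?thesis using hom_dvd[of a b] hom_dvd[of "swapX i a" "swapX i b"] i by (auto simp: swapX_swapX)
qed

text \<open>The exchange is its own inverse, hence a ring automorphism.\<close>

lemma prime_elem_swapX:
  assumes "i < 4" "prime_elem q"
  shows "prime_elem (swapX i q)"
proof -
  interpret comm_ring_hom "swapX i" by (rule comm_ring_hom_swapX)
  show ?thesis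
  proof (rule prime_elemI)
    show "swapX i q \<noteq> 0" using assms swapX_swapX[of i q] by auto
    show "\<not> swapX i q dvd 1" using assms swapX_dvd_iff[of i q 1] by (simp add: prime_elem_not_unit)
  next
    fix a b assume "swapX i q dvd a * b"
    then have "q dvd swapX i a * swapX i b"
      using assms(1) swapX_dvd_iff[of i "swapX i q" "a * b"] by (simp add: swapX_swapX hom_mult)
    then show "swapX i q dvd a \<or> swapX i q dvd b"
      using assms swapX_dvd_iff[of i q "swapX i a"] swapX_dvd_iff[of i q "swapX i b"]
      by (auto simp: swapX_swapX prime_elem_dvd_mult_iff)
  qed
qed

text \<open>An element of least degree divides \<open>f\<close> and \<open>g\<close> up to constants, by pseudo-division.\<close>

lemma ex_constant_in_ideal:
  fixes f :: "'a::idom poly" and I :: "'a poly set"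
  assumes add: "\<And>x y. x \<in> I \<Longrightarrow> y \<in> I \<Longrightarrow> x - y \<in> I" and mult: "\<And>x y. x \<in> I \<Longrightarrow> y * x \<in> I"
    and f: "prime_elem f" "f \<in> I" and g: "g \<in> I" "\<not> f dvd g"
  obtains r where "r \<in> I" "r \<noteq> 0" "degree r = 0"
proof -
  have "f \<noteq> 0" using f by auto
  then have ex: "\<exists>h. h \<in> I \<and> h \<noteq> 0" using f by blast
  define h where "h = arg_min degree (\<lambda>h. h \<in> I \<and> h \<noteq> 0)"
  have h: "h \<in> I" "h \<noteq> 0" and min: "\<And>r. r \<in> I \<Longrightarrow> r \<noteq> 0 \<Longrightarrow> degree h \<le> degree r"
    using arg_min_natI[of "\<lambda>h. h \<in> I \<and> h \<noteq> 0" _ degree] ex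
      arg_min_nat_le[of "\<lambda>h. h \<in> I \<and> h \<noteq> 0" _ degree] unfolding h_def by blast+
  have div: "\<exists>c q. c \<noteq> 0 \<and> [:c:] * x = h * q" if "x \<in> I" for x
  proof -
    obtain q r where qr: "pseudo_divmod x h = (q, r)" by fastforce
    let ?c = "lead_coeff h ^ (Suc (degree x) - degree h)"
    from pseudo_divmod[OF h(2) qr] have e: "Polynomial.smult ?c x = h * q + r" and d: "r = 0 \<or> degree r < degree h"
      by auto
    have "r = [:?c:] * x - q * h" using e by (simp add: algebra_simps)
    then have "r \<in> I" using add mult that h(1) by metis
    then have "r = 0" using d min by fastforce
    then show ?thesis using e h by (intro exI[of _ ?c] exI[of _ q]) simp
  qed
  obtain c q where cq: "c \<noteq> 0" "[:c:] * f = h * q" using div[OF f(2)] by blast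
  obtain c' q' where cq': "c' \<noteq> 0" "[:c':] * g = h * q'" using div[OF g(1)] by blast
  \<comment> \<open>The prime \<open>f\<close> divides one of the factors. If it divides
    \<open>h\<close>, it divides a constant times \<open>g\<close>, hence the constant, and
    \<open>f\<close> itself has degree 0; if it divides \<open>q\<close>, cancelling
    \<open>f\<close> leaves \<open>h\<close> as a divisor of a constant.\<close>
  have "f dvd h * q" using cq(2) by (metis dvd_triv_right)
  then consider "f dvd h" | "f dvd q" using f(1) by (auto simp: prime_elem_dvd_mult_iff)
  then show thesis
  proof cases
    case 1
    then have "f dvd [:c':] * g" using cq'(2) by (metis dvd_mult2)
    then have "f dvd [:c':]" using f(1) g(2) prime_elem_dvd_mult_iff by blast
    then have "degree f = 0" using cq'(1) dvd_imp_degree_le[of f "[:c':]"] by simp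
    then show thesis using that f \<open>f \<noteq> 0\<close> by blast
  next
    case 2
    then obtain s where "q = f * s" by blast
    then have "f * [:c:] = f * (h * s)" using cq(2) by (simp add: ac_simps)
    then have "[:c:] = h * s" using \<open>f \<noteq> 0\<close> by (metis mult_cancel_left)
    then have "h dvd [:c:]" by simp
    then have "degree h = 0" using cq(1) dvd_imp_degree_le[of h "[:c:]"] by simp
    then show thesis using that h by blast
  qed
qed

subsection \<open>Derivations and relations of minimal degree\<close>

text \<open>Vanishing on the base field is not built in; the chain rule below takes it as a separate
  assumption.\<close>

definition derivation :: "('a::comm_ring_1 \<Rightarrow> 'a) \<Rightarrow> bool" where
  "derivation D \<longleftrightarrow> (\<forall>x y. D (x + y) = D x + D y) \<and> (\<forall>x y. D (x * y) = D x * y + x * D y)"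

lemma derivation_add: "derivation D \<Longrightarrow> D (x + y) = D x + D y"
  and derivation_mult: "derivation D \<Longrightarrow> D (x * y) = D x * y + x * D y"
  by (simp_all add: derivation_def)

lemma derivation_0: "derivation D \<Longrightarrow> D 0 = 0"
  using derivation_add[of D 0 0] by simp

lemma derivation_1: "derivation D \<Longrightarrow> D 1 = 0"
  using derivation_mult[of D 1 1] by simp

lemma derivation_of_nat: "derivation D \<Longrightarrow> D (of_nat n) = 0"
  by (induction n) (simp_all add: derivation_0 derivation_1 derivation_add)

lemma derivation_sum: "derivation D \<Longrightarrow> D (sum f S) = (\<Sum>x\<in>S. D (f x))"
  by (induction S rule: infinite_finite_induct) (simp_all add: derivation_0 derivation_add)

lemma derivation_power: "derivation D \<Longrightarrow> D (x ^ n) = of_nat n * x ^ (n - 1) * D x"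
proof (induction n)
  case (Suc n)
  then show ?case by (cases n) (simp_all add: derivation_mult algebra_simps)
qed (simp add: derivation_1)

lemma derivation_pderiv: "derivation (pderiv :: 'a::idom poly \<Rightarrow> 'a poly)"
  by (simp add: derivation_def pderiv_add pderiv_mult algebra_simps)

text \<open>Acting on coefficients treats the outer variable as a constant; iterating this yields
  the partial derivatives in the inner variables.\<close>

lemma derivation_map_poly:
  assumes D: "derivation D"
  shows "derivation (map_poly D)"
  unfolding derivation_def
proof (intro conjI allI)
  note D_simps = derivation_0[OF D] derivation_add[OF D] derivation_mult[OF D] derivation_sum[OF D]
  fix q r
  show "map_poly D (q + r) = map_poly D q + map_poly D r"
    by (simp add: poly_eq_iff coeff_map_poly D_simps)
  show "map_poly D (q * r) = map_poly D q * r + q * map_poly D r"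
    by (simp add: poly_eq_iff coeff_map_poly D_simps coeff_mult sum.distrib)
qed

section \<open>Partial derivatives and the chain rule\<close>

definition dX :: "nat \<Rightarrow> 'k::idom xpoly \<Rightarrow> 'k xpoly" where
  "dX i = (if i = 0 then pderiv else if i = 1 then map_poly pderiv
     else if i = 2 then map_poly (map_poly pderiv) else map_poly (map_poly (map_poly pderiv)))"

definition dT :: "nat \<Rightarrow> 'k::idom tpoly \<Rightarrow> 'k tpoly" where
  "dT i = (if i = 0 then pderiv else if i = 1 then map_poly pderiv
     else map_poly (map_poly pderiv))"

lemma derivation_dX: "derivation (dX i)"
  by (simp add: dX_def derivation_map_poly derivation_pderiv)

lemma derivation_dT: "derivation (dT i)"
  by (simp add: dT_def derivation_map_poly derivation_pderiv)

lemma dX_constX: "dX i (constX c) = 0"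
  by (simp add: dX_def constX_def map_poly_pCons_hom pderiv_pCons)

lemma dT_constT: "dT i (constT c) = 0"
  by (simp add: dT_def constT_def map_poly_pCons_hom pderiv_pCons)

lemma dX_varX:
  assumes "i < 4" "j < 4"
  shows "dX i (varX j) = (if i = j then 1 else 0)"
proof -
  have "i = 0 \<or> i = 1 \<or> i = 2 \<or> i = 3" "j = 0 \<or> j = 1 \<or> j = 2 \<or> j = 3" using assms by linarith+
  then show ?thesis
    by (elim disjE) (simp_all add: dX_def varX_def map_poly_pCons_hom pderiv_pCons one_pCons)
qed

lemma dT_var [simp]:
  "dT 0 t1 = 1" "dT 0 t2 = 0" "dT 0 t3 = 0"
  "dT 1 t1 = 0" "dT 1 t2 = 1" "dT 1 t3 = 0"
  "dT (Suc 0) t1 = 0" "dT (Suc 0) t2 = 1" "dT (Suc 0) t3 = 0"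
  "dT 2 t1 = 0" "dT 2 t2 = 0" "dT 2 t3 = 1"
  by (simp_all add: dT_def t1_def t2_def t3_def map_poly_pCons_hom pderiv_pCons one_pCons)

lemma coeff_of_nat_mult: "coeff (of_nat n * q) k = of_nat n * coeff (q :: 'a::comm_ring_1 poly) k"
  by (simp add: of_nat_poly)

lemma coeffX_dX:
  "coeffX (dX 0 q) a b c e = of_nat (Suc a) * coeffX q (Suc a) b c e"
  "coeffX (dX 1 q) a b c e = of_nat (Suc b) * coeffX q a (Suc b) c e"
  "coeffX (dX 2 q) a b c e = of_nat (Suc c) * coeffX q a b (Suc c) e"
  "coeffX (dX 3 q) a b c e = of_nat (Suc e) * coeffX q a b c (Suc e)"
  by (simp_all add: dX_def coeffX_def coeff_map_poly coeff_pderiv coeff_of_nat_mult del: of_nat_Suc)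

lemma coeffT_dT:
  "coeffT (dT 0 q) a b c = of_nat (Suc a) * coeffT q (Suc a) b c"
  "coeffT (dT 1 q) a b c = of_nat (Suc b) * coeffT q a (Suc b) c"
  "coeffT (dT 2 q) a b c = of_nat (Suc c) * coeffT q a b (Suc c)"
  by (simp_all add: dT_def coeffT_def coeff_map_poly coeff_pderiv coeff_of_nat_mult del: of_nat_Suc)

lemma xpoly_eq_iff: "q = r \<longleftrightarrow> (\<forall>a b c e. coeffX q a b c e = coeffX r a b c e)"
  by (auto simp: coeffX_def poly_eq_iff)

lemma tpoly_eq_iff: "q = r \<longleftrightarrow> (\<forall>a b c. coeffT q a b c = coeffT r a b c)"
  by (auto simp: coeffT_def poly_eq_iff)

lemma coeffX_0 [simp]: "coeffX 0 a b c e = 0"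
  by (simp add: coeffX_def)

lemma dX_commute:
  assumes "i < 4" "j < 4"
  shows "dX i (dX j q) = dX j (dX i q)"
proof -
  have "i = 0 \<or> i = 1 \<or> i = 2 \<or> i = 3" "j = 0 \<or> j = 1 \<or> j = 2 \<or> j = 3" using assms by linarith+
  then show ?thesis
    by (elim disjE) (simp_all add: xpoly_eq_iff coeffX_dX mult.left_commute del: of_nat_Suc One_nat_def)
qed

text \<open>The chain rule. Both sides are additive and obey the Leibniz rule over the substitution,
  so comparing them on constants and variables suffices.\<close>

lemma derivation_substX:
  fixes D :: "'r::comm_ring_1 \<Rightarrow> 'r" and q :: "'k::idom xpoly"
  assumes h: "comm_ring_hom h" and D: "derivation D" and const: "\<And>c. D (h c) = 0"
  shows "D (substX h v q) = (\<Sum>i<4. substX h v (dX i q) * D (v i))"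
proof -
  interpret ev: comm_ring_hom "substX h v" by (rule comm_ring_hom_substX[OF h])
  show ?thesis
  proof (induction q rule: xpoly_ring_induct)
    case (1 c)
    show ?case by (simp add: substX_constX[OF h] const dX_constX)
  next
    case (2 j)
    have "(\<Sum>i<4. substX h v (dX i (varX j)) * D (v i)) = (\<Sum>i<4. if i = j then D (v i) else 0)"
      using 2 by (intro sum.cong) (simp_all add: dX_varX)
    then show ?case using 2 by (simp add: substX_varX[OF h])
  next
    case (3 q r)
    then show ?case
      by (simp add: derivation_add[OF D] derivation_add[OF derivation_dX] ev.hom_add sum.distrib distrib_right)
  next
    case (4 q r)
    then show ?case
      by (simp add: derivation_mult[OF D] derivation_mult[OF derivation_dX] ev.hom_add ev.hom_mult sum.distrib
          distrib_right distrib_left sum_distrib_left sum_distrib_right ac_simps)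
  qed
qed

lemma dX_swapX:
  assumes i: "i < 4" and q: "dX 0 q = 0"
  shows "dX i (swapX i q) = 0"
proof -
  have "dX i (swapX i q) = (\<Sum>j<4. swapX i (dX j q) * dX i (varX (transpose 0 i j)))"
    unfolding swapX_def by (rule derivation_substX[OF comm_ring_hom_constX derivation_dX dX_constX])
  also have "\<dots> = 0"
  proof (intro sum.neutral ballI)
    fix j :: nat assume j: "j \<in> {..<4}"
    interpret comm_ring_hom "swapX i" by (rule comm_ring_hom_swapX)
    show "swapX i (dX j q) * dX i (varX (transpose 0 i j)) = 0"
    proof (cases "j = 0")
      case False
      then have "transpose 0 i j \<noteq> i" "transpose 0 i j < 4" using i j by (auto simp: transpose_def)
      then show ?thesis using i by (simp add: dX_varX)
    qed (simp add: q)
  qed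
  finally show ?thesis .
qed

lemma finite_supportX: "finite {(a, b, c, e). coeffX q a b c e \<noteq> 0}"
proof (rule finite_subset)
  show "{(a, b, c, e). coeffX q a b c e \<noteq> 0} \<subseteq> (SIGMA a:{..degree q}. SIGMA b:{..degree (coeff q a)}.
      SIGMA c:{..degree (coeff (coeff q a) b)}. {..degree (coeff (coeff (coeff q a) b) c)})"
    by (auto simp: coeffX_def intro!: le_degree)
qed (intro finite_SigmaI finite_atMost)

lemma finite_supportT: "finite {(a, b, c). coeffT q a b c \<noteq> 0}"
proof (rule finite_subset)
  show "{(a, b, c). coeffT q a b c \<noteq> 0} \<subseteq> (SIGMA a:{..degree q}. SIGMA b:{..degree (coeff q a)}.
      {..degree (coeff (coeff q a) b)})"
    by (auto simp: coeffT_def intro!: le_degree)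
qed (intro finite_SigmaI finite_atMost)

definition total_degree_le :: "nat \<Rightarrow> 'k::zero xpoly \<Rightarrow> bool" where
  "total_degree_le n q \<longleftrightarrow> (\<forall>a b c e. coeffX q a b c e \<noteq> 0 \<longrightarrow> a + b + c + e \<le> n)"

lemma ex_total_degree_le: "\<exists>n. total_degree_le n q"
proof -
  let ?S = "{(a, b, c, e). coeffX q a b c e \<noteq> 0}"
  have "a + b + c + e \<le> (\<Sum>(a, b, c, e)\<in>?S. a + b + c + e)" if "coeffX q a b c e \<noteq> 0" for a b c e
    using member_le_sum[OF _ _ finite_supportX, of "(a, b, c, e)" q "\<lambda>(a, b, c, e). a + b + c + e"] that
    by simp
  then show ?thesis unfolding total_degree_le_def by blast
qed

lemma total_degree_le_dX:
  fixes q :: "'k::{idom, ring_char_0} xpoly"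
  assumes "total_degree_le (Suc n) q" "i < 4"
  shows "total_degree_le n (dX i q)"
proof -
  have "i = 0 \<or> i = 1 \<or> i = 2 \<or> i = 3" using assms by linarith
  then show ?thesis using assms(1) unfolding total_degree_le_def
    by (elim disjE) (fastforce simp: coeffX_dX simp del: of_nat_Suc One_nat_def)+
qed

text \<open>In characteristic zero, if all partial derivatives vanish, so does every coefficient
  with a positive exponent.\<close>

lemma ex_dX_nonzero:
  fixes q :: "'k::{idom, ring_char_0} xpoly"
  assumes "coeffX q a b c e \<noteq> 0" "a + b + c + e \<noteq> 0"
  shows "\<exists>i<4. dX i q \<noteq> 0"
proof (rule ccontr)
  assume "\<not> ?thesis"
  then have z: "dX 0 q = 0" "dX 1 q = 0" "dX 2 q = 0" "dX 3 q = 0" by auto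
  have "coeffX q (Suc a) b c e = 0" "coeffX q a (Suc b) c e = 0" "coeffX q a b (Suc c) e = 0"
    "coeffX q a b c (Suc e) = 0" for a b c e
    using coeffX_dX[of q a b c e] unfolding z by (auto simp del: of_nat_Suc)
  then show False using assms by (metis add_is_0 not0_implies_Suc)
qed

lemma coeffX_constX: "coeffX (constX k) a b c e = (if a = 0 \<and> b = 0 \<and> c = 0 \<and> e = 0 then k else 0)"
  by (simp add: constX_def coeffX_def coeff_pCons split: nat.splits)

lemma total_degree_le_0_const:
  assumes "total_degree_le 0 q"
  shows "q = constX (coeffX q 0 0 0 0)"
  using assms by (auto simp: xpoly_eq_iff total_degree_le_def coeffX_constX)

text \<open>A relation of minimal total degree stops being a relation after some partial differentiation.\<close>

lemma relation_nonzero_gradient: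
  fixes p :: "nat \<Rightarrow> 'k::{idom, ring_char_0} tpoly"
  assumes R: "R \<noteq> 0" "evalX p R = 0" "dX l R = 0" and l: "l < 4"
  obtains R' i where "evalX p R' = 0" "dX l R' = 0" "i < 4" "evalX p (dX i R') \<noteq> 0"
proof -
  have "\<exists>R' i. evalX p R' = 0 \<and> dX l R' = 0 \<and> i < 4 \<and> evalX p (dX i R') \<noteq> 0"
    if "total_degree_le n R" "R \<noteq> 0" "evalX p R = 0" "dX l R = 0" for n R
    using that
  proof (induction n arbitrary: R)
    case 0
    have R: "R = constX (coeffX R 0 0 0 0)" using total_degree_le_0_const 0 by blast
    have "evalX p R = constT (coeffX R 0 0 0 0)"
      by (subst R) (simp add: evalX_eq_substX substX_constX comm_ring_hom_constT)
    then have "coeffX R 0 0 0 0 = 0" using 0 by (simp add: constT_def)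
    with R 0 show ?case by (simp add: constX_def)
  next
    case (Suc n)
    show ?case
    proof (cases "\<exists>i<4. dX i R \<noteq> 0")
      case True
      then obtain i where i: "i < 4" "dX i R \<noteq> 0" by blast
      show ?thesis
      proof (cases "evalX p (dX i R) = 0")
        case True
        have "dX l (dX i R) = 0" using Suc.prems i l by (simp add: dX_commute[of l i] derivation_0[OF derivation_dX])
        then show ?thesis using Suc.IH[of "dX i R"] total_degree_le_dX[OF Suc.prems(1) i(1)] i True by blast
      qed (use Suc.prems i in blast)
    next
      case False
      \<comment> \<open>With all partial derivatives zero only the constant term can survive, so the
        induction hypothesis applies to \<open>R\<close> itself.\<close>
      then have "total_degree_le n R"
        using ex_dX_nonzero[of R] unfolding total_degree_le_def by (metis le0)
      then show ?thesis using Suc by blast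
    qed
  qed
  then show thesis using that ex_total_degree_le[of R] R by blast
qed

subsection \<open>The kernel of the parametrization\<close>

text \<open>A derivation killing the coefficients of an algebraic relation of a/b kills a/b; by the
  quotient rule this is the conclusion with denominators cleared. Differentiating the relation
  yields either the claim or a relation of smaller degree, so no minimal polynomial is
  required.\<close>

lemma derivation_algebraic:
  fixes D :: "'a::{idom, ring_char_0} \<Rightarrow> 'a"
  assumes D: "derivation D" and b: "b \<noteq> 0"
    and "\<And>k. D (g k) = 0" "\<exists>k\<le>N. g k \<noteq> 0" "(\<Sum>k\<le>N. g k * a ^ k * b ^ (N - k)) = 0"
  shows "b * D a = a * D b"
  using assms(3-)
proof (induction N arbitrary: g)
  case 0
  then show ?case by simp
next
  case (Suc N)
  let ?W = "b * D a - a * D b"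
  \<comment> \<open>The last summand depends on the exponents only through \<open>k + j\<close>,
    which is constant along the homogeneous relation; its total contribution is a multiple of that
    relation and vanishes.\<close>
  have mon: "b * D (a ^ k * b ^ j) = of_nat k * a ^ (k - 1) * b ^ j * ?W + of_nat (k + j) * (a ^ k * b ^ j) * D b" for k j
    unfolding derivation_mult[OF D] derivation_power[OF D] by (cases k; cases j) (simp_all add: algebra_simps)
  let ?S = "\<Sum>k\<le>N. (of_nat (Suc k) * g (Suc k)) * a ^ k * b ^ (N - k)"
  have "0 = b * D (\<Sum>k\<le>Suc N. g k * a ^ k * b ^ (Suc N - k))"
    using Suc.prems(3) by (simp add: derivation_0[OF D])
  also have "\<dots> = (\<Sum>k\<le>Suc N. g k * (b * D (a ^ k * b ^ (Suc N - k))))"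
    unfolding derivation_sum[OF D] sum_distrib_left
    by (intro sum.cong refl) (simp only: mult.assoc derivation_mult[OF D, of "g _"] Suc.prems(1), simp add: ac_simps)
  also have "\<dots> = (\<Sum>k\<le>Suc N. ?W * (of_nat k * g k * a ^ (k - 1) * b ^ (Suc N - k))
      + of_nat (Suc N) * D b * (g k * a ^ k * b ^ (Suc N - k)))"
    by (intro sum.cong refl) (simp add: mon algebra_simps del: of_nat_Suc of_nat_add)
  also have "\<dots> = ?W * (\<Sum>k\<le>Suc N. of_nat k * g k * a ^ (k - 1) * b ^ (Suc N - k))"
    unfolding sum.distrib sum_distrib_left[symmetric] Suc.prems(3) by simp
  also have "(\<Sum>k\<le>Suc N. of_nat k * g k * a ^ (k - 1) * b ^ (Suc N - k)) = ?S"
    by (subst sum.atMost_Suc_shift) (simp del: of_nat_Suc)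
  finally consider "?W = 0" | "?S = 0" by auto
  then show ?case
  proof cases
    case 2
    have "\<exists>k\<le>N. of_nat (Suc k) * g (Suc k) \<noteq> 0"
    proof (rule ccontr)
      assume "\<not> ?thesis"
      \<comment> \<open>In characteristic zero a trivial derived relation leaves only
        \<open>g 0 * b ^ Suc N = 0\<close>, which is impossible.\<close>
      then have z: "g (Suc k) = 0" if "k \<le> N" for k using that by (auto simp del: of_nat_Suc)
      then have "g 0 \<noteq> 0" using Suc.prems(2) by (metis Suc_le_mono not0_implies_Suc)
      moreover have "(\<Sum>k\<le>Suc N. g k * a ^ k * b ^ (Suc N - k)) = g 0 * b ^ Suc N"
        by (subst sum.atMost_Suc_shift) (simp add: z)
      ultimately show False using Suc.prems(3) b by simp
    qed
    then show ?thesis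
      using Suc.IH[of "\<lambda>k. of_nat (Suc k) * g (Suc k)"] 2 Suc.prems(1)
      by (simp add: derivation_mult[OF D] derivation_of_nat[OF D] del: of_nat_Suc)
  qed simp
qed

section \<open>Euler's identity and vector fields killing the parametrization\<close>

lemma coeffT_var_mult:
  "coeffT (t1 * q) a b c = (case a of 0 \<Rightarrow> 0 | Suc a \<Rightarrow> coeffT (q :: 'k::comm_ring_1 tpoly) a b c)"
  "coeffT (t2 * q) a b c = (case b of 0 \<Rightarrow> 0 | Suc b \<Rightarrow> coeffT q a b c)"
  "coeffT (t3 * q) a b c = (case c of 0 \<Rightarrow> 0 | Suc c \<Rightarrow> coeffT q a b c)"
  by (simp_all add: coeffT_def t1_def t2_def t3_def coeff_pCons split: nat.splits)

text \<open>Multiplying a partial derivative by its variable scales each coefficient by the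
  corresponding exponent, and these exponents sum to \<open>n\<close>.\<close>

lemma euler_homogT:
  fixes q :: "'k::idom tpoly"
  assumes "homogT n q"
  shows "t1 * dT 0 q + t2 * dT 1 q + t3 * dT 2 q = of_nat n * q"
proof -
  have "of_nat a * coeffT q a b c + of_nat b * coeffT q a b c + of_nat c * coeffT q a b c = of_nat n * coeffT q a b c"
    for a b c
    using assms unfolding homogT_def by (metis distrib_right mult_zero_right of_nat_add)
  moreover have "coeffT (x + y) a b c = coeffT x a b c + coeffT y a b c" for x y :: "'k tpoly" and a b c
    by (simp add: coeffT_def)
  moreover have "coeffT (t1 * dT 0 q) a b c = of_nat a * coeffT q a b c"
    "coeffT (t2 * dT 1 q) a b c = of_nat b * coeffT q a b c"
    "coeffT (t3 * dT 2 q) a b c = of_nat c * coeffT q a b c" for a b c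
    by (cases a; cases b; cases c; simp add: coeffT_var_mult coeffT_dT del: of_nat_Suc One_nat_def)+
  moreover have "coeffT (of_nat n * q) a b c = of_nat n * coeffT q a b c" for a b c
    by (simp add: coeffT_def coeff_of_nat_mult)
  ultimately show ?thesis by (simp add: tpoly_eq_iff)
qed

lemma coeffT_constT: "coeffT (constT k) a b c = (if a = 0 \<and> b = 0 \<and> c = 0 then k else 0)"
  by (simp add: constT_def coeffT_def coeff_pCons split: nat.splits)

lemma homogT_0_const:
  assumes "homogT 0 q"
  shows "q = constT (coeffT q 0 0 0)"
  using assms by (auto simp: tpoly_eq_iff homogT_def coeffT_constT)

lemma t_nonzero: "t1 \<noteq> (0 :: 'k::comm_ring_1 tpoly)" "t2 \<noteq> (0 :: 'k tpoly)" "t3 \<noteq> (0 :: 'k tpoly)"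
  by (simp_all add: t1_def t2_def t3_def)

lemma homogT_vars: "homogT 1 (t1 :: 'k::comm_ring_1 tpoly)" "homogT 1 (t2 :: 'k tpoly)" "homogT 1 (t3 :: 'k tpoly)"
  by (auto simp: homogT_def coeffT_def t1_def t2_def t3_def coeff_pCons split: nat.splits if_splits)

lemma derivation_combination:
  "derivation (\<lambda>f. u * dT 0 f + v * dT 1 f + w * dT 2 f)"
  by (simp add: derivation_def derivation_add[OF derivation_dT] derivation_mult[OF derivation_dT] algebra_simps)

text \<open>By the chain rule the derivation with components \<open>u\<close>, \<open>v\<close>,
  \<open>w\<close> kills the image of \<open>evalX p\<close>. Generic finiteness makes t1/t3 and
  t2/t3 algebraic over quotients of such elements, so it kills them too.\<close>

lemma vector_field_radial:
  fixes p :: "nat \<Rightarrow> 'k::{idom, ring_char_0} tpoly"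
  assumes gf: "generically_finite p"
    and vp: "\<And>c. c < 4 \<Longrightarrow> u * dT 0 (p c) + v * dT 1 (p c) + w * dT 2 (p c) = 0"
  shows "t3 * u = t1 * w" "t3 * v = t2 * w"
proof -
  define D where "D = (\<lambda>f. u * dT 0 f + v * dT 1 f + w * dT 2 f)"
  have D: "derivation D" unfolding D_def by (rule derivation_combination)
  have "D (evalX p q) = (\<Sum>i<4. evalX p (dX i q) * D (p i))" for q
    unfolding evalX_eq_substX by (rule derivation_substX[OF comm_ring_hom_constT D]) (simp add: D_def dT_constT)
  then have ev: "D (evalX p q) = 0" for q using vp by (simp add: D_def)
  have alg: "t3 * D a = a * D t3" if a: "homogT 1 a" for a
  proof -
    obtain N G where "\<exists>k\<le>N. evalX p (G k) \<noteq> 0"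
        and "(\<Sum>k\<le>N. evalX p (G k) * a ^ k * t3 ^ (N - k)) = 0"
      using gf a homogT_vars(3) t_nonzero(3) unfolding generically_finite_def by blast
    then show ?thesis by (rule derivation_algebraic[OF D t_nonzero(3) ev])
  qed
  show "t3 * u = t1 * w" "t3 * v = t2 * w"
    using alg[OF homogT_vars(1)] alg[OF homogT_vars(2)] by (simp_all add: D_def)
qed

text \<open>A nonzero radial field acts on forms like a multiple of the Euler derivation, which
  would force every \<open>p c\<close> to be zero or constant.\<close>

lemma vector_field_zero:
  fixes p :: "nat \<Rightarrow> 'k::{idom, ring_char_0} tpoly"
  assumes p: "param p" and gf: "generically_finite p"
    and vp: "\<And>c. c < 4 \<Longrightarrow> u * dT 0 (p c) + v * dT 1 (p c) + w * dT 2 (p c) = 0"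
  shows "u = 0 \<and> v = 0 \<and> w = 0"
proof -
  have r: "t3 * u = t1 * w" "t3 * v = t2 * w" using vector_field_radial[OF gf, of u v w] vp by blast+
  show ?thesis
  proof (cases "w = 0")
    case True
    then show ?thesis using r t_nonzero(3) by (metis mult_eq_0_iff)
  next
    case False
    obtain n where n: "\<And>c. c < 4 \<Longrightarrow> homogT n (p c)" using p unfolding param_def by blast
    have "of_nat n * p c = 0" if c: "c < 4" for c
    proof -
      have "w * (of_nat n * p c) = w * (t1 * dT 0 (p c) + t2 * dT 1 (p c) + t3 * dT 2 (p c))"
        using euler_homogT[OF n[OF c]] by simp
      also have "\<dots> = (t1 * w) * dT 0 (p c) + (t2 * w) * dT 1 (p c) + t3 * w * dT 2 (p c)"
        by (simp add: algebra_simps)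
      also have "\<dots> = t3 * (u * dT 0 (p c) + v * dT 1 (p c) + w * dT 2 (p c))"
        unfolding r[symmetric] by (simp add: algebra_simps)
      finally show ?thesis using vp[OF c] False by simp
    qed
    then have "n = 0 \<or> p c = 0" if "c < 4" for c using that by auto
    then have "dT j (p c) = 0" if "c < 4" for c j
      using that n[OF that] homogT_0_const[of "p c"] by (metis derivation_0 derivation_dT dT_constT)
    \<comment> \<open>All gradients now vanish, so the constant field (1, 0, 0) also kills the
      parametrization and would have to be radial.\<close>
    then have "t3 * 1 = t1 * (0 :: 'k tpoly)" by (intro vector_field_radial(1)[OF gf, of 1 0 0]) simp
    then show ?thesis by (simp add: t_nonzero)
  qed
qed

text \<open>The triple product, with the cross product of \<open>x\<close> and \<open>y\<close> as
  coefficients of \<open>z\<close>: its vanishing says that this cross product, read as a vector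
  field, annihilates \<open>z\<close>.\<close>

definition det3 :: "(nat \<Rightarrow> 'a::comm_ring_1) \<Rightarrow> (nat \<Rightarrow> 'a) \<Rightarrow> (nat \<Rightarrow> 'a) \<Rightarrow> 'a" where
  "det3 x y z = (x 1 * y 2 - x 2 * y 1) * z 0 + (x 2 * y 0 - x 0 * y 2) * z 1 + (x 0 * y 1 - x 1 * y 0) * z 2"

text \<open>Cramer's rule without division: scaling a row by its coefficient turns that row into the
  vanishing combination, up to multiples of the other two rows.\<close>

lemma det3_dependent:
  assumes "\<And>j. j < 3 \<Longrightarrow> r * x j + s * y j + t * z j = 0"
  shows "r * det3 x y z = 0" "s * det3 x y z = 0" "t * det3 x y z = 0"
proof -
  define f where "f j = r * x j + s * y j + t * z j" for j
  have f: "f 0 = 0" "f 1 = 0" "f 2 = 0" using assms by (simp_all add: f_def)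
  have "r * det3 x y z = det3 f y z" by (simp add: det3_def f_def algebra_simps)
  then show "r * det3 x y z = 0" by (simp only: det3_def f) simp
  have "s * det3 x y z = det3 x f z" by (simp add: det3_def f_def algebra_simps)
  then show "s * det3 x y z = 0" by (simp only: det3_def f) simp
  have "t * det3 x y z = det3 x y f" by (simp add: det3_def f_def algebra_simps)
  then show "t * det3 x y z = 0" by (simp only: det3_def f) simp
qed

lemma det3_repeat: "det3 x y x = 0" "det3 x y y = 0" "det3 x x z = 0"
  by (simp_all add: det3_def algebra_simps)

text \<open>After the exchange, the kernel contains a prime and a non-multiple of it, hence a
  nonzero element free of the outermost variable; exchanging back gives \<open>R\<close>.\<close>

lemma ex_relation_without_variable:
  fixes p :: "nat \<Rightarrow> 'k::idom tpoly"
  assumes F: "prime_elem F" "evalX p F = 0" and G: "evalX p G = 0" "\<not> F dvd G" and i: "i < 4"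
  obtains R where "R \<noteq> 0" "evalX p R = 0" "dX i R = 0"
proof -
  interpret sw: comm_ring_hom "swapX i" by (rule comm_ring_hom_swapX)
  interpret ev: comm_ring_hom "evalX p" by (rule comm_ring_hom_evalX)
  obtain r where r: "r \<in> {q. evalX p (swapX i q) = 0}" "r \<noteq> 0" "degree r = 0"
  proof (rule ex_constant_in_ideal[of "{q. evalX p (swapX i q) = 0}" "swapX i F" "swapX i G"])
    fix x y assume "x \<in> {q. evalX p (swapX i q) = 0}"
    then show "y * x \<in> {q. evalX p (swapX i q) = 0}" by (simp add: sw.hom_mult ev.hom_mult)
  qed (use F G i in \<open>simp_all add: sw.hom_minus ev.hom_minus swapX_swapX swapX_dvd_iff prime_elem_swapX\<close>)
  obtain a where a: "r = [:a:]" using r(3) by (rule degree_eq_zeroE)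
  show thesis
  proof (rule that)
    show "swapX i r \<noteq> 0" using r(2) swapX_swapX[OF i, of r] by auto
    show "evalX p (swapX i r) = 0" using r(1) by simp
    show "dX i (swapX i r) = 0" by (rule dX_swapX[OF i]) (simp add: a dX_def pderiv_pCons)
  qed
qed

text \<open>Allows nonvanishing modulo \<open>F\<close> to be tested after substitution. Given a
  kernel element that is not a multiple of \<open>F\<close>, first all triple products of gradients
  vanish, then all cross products, then the gradients themselves.\<close>

lemma evalX_kernel:
  fixes p :: "nat \<Rightarrow> 'k::{idom, ring_char_0} tpoly"
  assumes p: "param p" and gf: "generically_finite p"
    and F: "prime_elem F" "evalX p F = 0" and G: "evalX p G = 0"
  shows "F dvd G"
proof (rule ccontr)
  assume nd: "\<not> F dvd G"
  define g where "g c j = dT j (p c)" for c j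
  have det: "det3 (g a) (g b) (g c) = 0" if abc: "a < 4" "b < 4" "c < 4" for a b c
  proof (cases "a \<noteq> b \<and> a \<noteq> c \<and> b \<noteq> c")
    case True
    then have "card ({..<4} - {a, b, c}) = 1" using abc by (subst card_Diff_subset) auto
    then obtain l where "{..<4} - {a, b, c} = {l}" by (rule card_1_singletonE)
    then have l: "{..<4} = {a, b, c, l}" "l < 4" "l \<notin> {a, b, c}" using abc by blast+
    obtain R where "R \<noteq> 0" "evalX p R = 0" "dX l R = 0"
      using ex_relation_without_variable[OF F G nd l(2)] by blast
    then obtain R i where R: "evalX p R = 0" "dX l R = 0" "i < 4" "evalX p (dX i R) \<noteq> 0"
      using relation_nonzero_gradient[of R p l] l(2) by metis
    define r where "r c = evalX p (dX c R)" for c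
    have rl: "r l = 0" by (simp add: r_def R(2) evalX_def)
    have "r a * g a j + r b * g b j + r c * g c j = 0" for j
    proof -
      have "0 = dT j (evalX p R)" by (simp add: R(1) derivation_0[OF derivation_dT])
      also have "\<dots> = (\<Sum>c<4. r c * g c j)" unfolding evalX_eq_substX r_def g_def
        by (rule derivation_substX[OF comm_ring_hom_constT derivation_dT dT_constT])
      also have "\<dots> = r a * g a j + r b * g b j + r c * g c j"
        unfolding l(1) using True l(3) rl by (auto simp: algebra_simps)
      finally show ?thesis by simp
    qed
    note dep = det3_dependent[OF this]
    \<comment> \<open>The nonzero coefficient belongs to one of the three gradients, because
      \<open>R\<close> does not involve the variable with index \<open>l\<close>.\<close>
    have "i \<in> {a, b, c, l}" using R(3) l(1) by blast
    then have "r a \<noteq> 0 \<or> r b \<noteq> 0 \<or> r c \<noteq> 0" using R(4) rl by (auto simp: r_def)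
    then show ?thesis using dep by auto
  qed (auto simp: det3_repeat)
  have zero: "u = 0 \<and> v = 0 \<and> w = 0" if "\<And>c. c < 4 \<Longrightarrow> u * g c 0 + v * g c 1 + w * g c 2 = 0" for u v w
    using vector_field_zero[OF p gf, of u v w] that by (simp add: g_def)
  \<comment> \<open>The cross product of two gradients is a field killing every \<open>p c\<close>,
    since all triple products vanish.\<close>
  have cross: "g a 1 * g b 2 - g a 2 * g b 1 = 0 \<and> g a 2 * g b 0 - g a 0 * g b 2 = 0 \<and> g a 0 * g b 1 - g a 1 * g b 0 = 0"
    if "a < 4" "b < 4" for a b
    by (rule zero) (use det[OF that] in \<open>simp add: det3_def\<close>)
  have "g a 0 = 0 \<and> g a 1 = 0 \<and> g a 2 = 0" if a: "a < 4" for a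
  proof -
    \<comment> \<open>All gradients being parallel, any field orthogonal to \<open>g a\<close> kills
      every \<open>p c\<close>. Two such fields together display all three components of
      \<open>g a\<close>.\<close>
    have "0 * g c 0 + g a 2 * g c 1 + (- g a 1) * g c 2 = 0" if "c < 4" for c
      using cross[OF a that] by (simp add: algebra_simps)
    moreover have "g a 2 * g c 0 + 0 * g c 1 + (- g a 0) * g c 2 = 0" if "c < 4" for c
      using cross[OF a that] by (simp add: algebra_simps)
    ultimately show ?thesis using zero[of 0 "g a 2" "- g a 1"] zero[of "g a 2" 0 "- g a 0"] by simp
  qed
  then show False using zero[of 1 0 0] by simp
qed

subsection \<open>Maximal minors\<close>

text \<open>Induction on the number of columns: either the first \<open>k\<close> columns are
  already dependent modulo \<open>F\<close>, or a \<open>k\<close>-minor survives and the cofactors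
  of a bordering row give the dependence. Row choices \<open>f\<close> may repeat, so any row can be
  used as the border.\<close>

lemma minors_dvd_imp_dependent:
  fixes A :: "nat \<Rightarrow> nat \<Rightarrow> 'a::comm_ring_1"
  assumes "\<not> F dvd 1"
    and "\<And>f. (\<And>a. a < k \<Longrightarrow> f a < n) \<Longrightarrow> F dvd det (mat k k (\<lambda>(a, b). A (f a) b))"
  shows "\<exists>c. (\<exists>j<k. \<not> F dvd c j) \<and> (\<forall>i<n. F dvd (\<Sum>j<k. c j * A i j))"
  using assms(2)
proof (induction k)
  case 0
  \<comment> \<open>The empty determinant is 1.\<close>
  have "F dvd 1" using 0[of id] by (simp add: det_dim_zero[of "mat 0 0 _"])
  with assms(1) show ?case by blast
next
  case (Suc k)
  show ?case
  proof (cases "\<forall>f. (\<forall>a<k. f a < n) \<longrightarrow> F dvd det (mat k k (\<lambda>(a, b). A (f a) b))")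
    case True
    then obtain c where c: "\<exists>j<k. \<not> F dvd c j" "\<forall>i<n. F dvd (\<Sum>j<k. c j * A i j)" using Suc.IH by blast
    define c' where "c' j = (if j < k then c j else 0)" for j
    have "(\<Sum>j<Suc k. c' j * A i j) = (\<Sum>j<k. c j * A i j)" for i by (simp add: c'_def)
    moreover have "\<exists>j<Suc k. \<not> F dvd c' j" using c(1) by (auto simp: c'_def intro: less_SucI)
    ultimately show ?thesis using c(2) by (intro exI[of _ c']) simp
  next
    case False
    then obtain f where f: "\<And>a. a < k \<Longrightarrow> f a < n" "\<not> F dvd det (mat k k (\<lambda>(a, b). A (f a) b))" by blast
    \<comment> \<open>These are the cofactors along the last row of the matrix with rows
      \<open>f 0, ..., f (k - 1), i\<close>. They do not depend on \<open>i\<close>, so one choice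
      serves all rows.\<close>
    define c where "c j = (-1) ^ (k + j) * det (mat k k (\<lambda>(a, b). A (f a) (if b < j then b else Suc b)))" for j
    have "F dvd (\<Sum>j<Suc k. c j * A i j)" if i: "i < n" for i
    proof -
      define N where "N = mat (Suc k) (Suc k) (\<lambda>(a, b). A ((f(k := i)) a) b)"
      have N: "N \<in> carrier_mat (Suc k) (Suc k)" by (simp add: N_def)
      have "mat_delete N k j = mat k k (\<lambda>(a, b). A (f a) (if b < j then b else Suc b))" for j
        by (rule eq_matI) (auto simp: mat_delete_def N_def)
      then have "cofactor N k j = c j" for j by (simp add: cofactor_def c_def)
      then have "det N = (\<Sum>j<Suc k. N $$ (k, j) * c j)" using laplace_expansion_row[OF N, of k] by simp
      also have "\<dots> = (\<Sum>j<Suc k. c j * A i j)" by (intro sum.cong refl) (simp add: N_def mult.commute)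
      finally have "(\<Sum>j<Suc k. c j * A i j) = det N" ..
      moreover have "F dvd det N" unfolding N_def by (rule Suc.prems) (use f i in \<open>auto simp: less_Suc_eq\<close>)
      ultimately show ?thesis by simp
    qed
    moreover have "c k = det (mat k k (\<lambda>(a, b). A (f a) b))"
      by (simp add: c_def mult_2[symmetric]) (intro arg_cong[of _ _ det] eq_matI; simp)
    ultimately show ?thesis using f(2) by (intro exI[of _ c]) auto
  qed
qed

text \<open>A surviving minor has no repeated rows, so it omits exactly one row \<open>r\<close> and
  agrees with the minor deleting \<open>r\<close> up to sign.\<close>

lemma ex_maximal_minor_not_dvd:
  assumes F: "\<not> F dvd 1" and A: "dim_row A = Suc k" "dim_col A = k" and rank: "full_col_rank_mod F A"
  obtains r where "r < Suc k" "\<not> F dvd det (delete_row r A)"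
proof -
  have "\<exists>f. (\<forall>a<k. f a < Suc k) \<and> \<not> F dvd det (mat k k (\<lambda>(a, b). A $$ (f a, b)))"
  proof (rule ccontr)
    assume "\<not> ?thesis"
    then obtain c where "\<exists>j<k. \<not> F dvd c j" "\<forall>i<Suc k. F dvd (\<Sum>j<k. c j * A $$ (i, j))"
      using minors_dvd_imp_dependent[OF F, of k "Suc k" "\<lambda>i j. A $$ (i, j)"] by blast
    then show False using rank A unfolding full_col_rank_mod_def by auto
  qed
  then obtain f where f: "\<And>a. a < k \<Longrightarrow> f a < Suc k" "\<not> F dvd det (mat k k (\<lambda>(a, b). A $$ (f a, b)))" by blast
  have inj: "inj_on f {..<k}"
  proof (rule ccontr)
    assume "\<not> ?thesis"
    then obtain a b where ab: "a < k" "b < k" "a \<noteq> b" "f a = f b" unfolding inj_on_def by auto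
    have "det (mat k k (\<lambda>(a, b). A $$ (f a, b))) = 0"
      by (rule det_identical_rows[of _ k a b]) (use ab in \<open>auto intro: eq_vecI\<close>)
    then show False using f(2) by simp
  qed
  have "card (f ` {..<k}) < card {..<Suc k}" by (simp add: card_image[OF inj])
  then obtain r where r: "r < Suc k" "r \<notin> f ` {..<k}"
    by (metis card_mono finite_imageI finite_lessThan lessThan_iff not_less subsetI)
  \<comment> \<open>Position of row \<open>f a\<close> once row \<open>r\<close> is deleted; the
    identity from \<open>k\<close> on makes \<open>s\<close> a permutation of
    \<open>{0..<k}\<close>.\<close>
  define s where "s a = (if a < k then if f a < r then f a else f a - 1 else a)" for a
  have fs: "f a = (if s a < r then s a else Suc (s a))" "s a < k" if "a < k" for a
  proof -
    have "f a \<noteq> r" "f a < Suc k" using that r f(1) by auto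
    then show "f a = (if s a < r then s a else Suc (s a))" "s a < k" using that r(1) by (auto simp: s_def)
  qed
  have "inj_on s {0..<k}"
  proof (rule inj_onI)
    fix a b assume "a \<in> {0..<k}" "b \<in> {0..<k}" "s a = s b"
    then show "a = b" using fs(1)[of a] fs(1)[of b] inj by (auto simp: inj_on_def)
  qed
  moreover have "s ` {0..<k} \<subseteq> {0..<k}" using fs(2) by auto
  ultimately have "bij_betw s {0..<k} {0..<k}" unfolding bij_betw_def by (simp add: endo_inj_surj)
  then have "s permutes {0..<k}" by (rule bij_imp_permutes) (simp add: s_def)
  then have "det (mat k k (\<lambda>(i, j). delete_row r A $$ (s i, j))) = of_int (sign s) * det (delete_row r A)"
    by (intro det_permute_rows) (simp add: delete_row_def A)
  moreover have "mat k k (\<lambda>(i, j). delete_row r A $$ (s i, j)) = mat k k (\<lambda>(a, b). A $$ (f a, b))"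
    by (rule eq_matI) (auto simp: delete_row_def A fs)
  ultimately have "\<not> F dvd det (delete_row r A)" using f(2) by (metis dvd_mult)
  then show thesis using r that by blast
qed

text \<open>The cofactors along a column placed in front of \<open>A\<close>.\<close>

definition signed_minor :: "'a::comm_ring_1 mat \<Rightarrow> nat \<Rightarrow> 'a" where
  "signed_minor A i = (-1) ^ i * det (delete_row i A)"

lemma cofactor_first_col:
  assumes "N \<in> carrier_mat (Suc k) (Suc k)" "i < Suc k"
  shows "cofactor N i 0 = signed_minor (erase_first_col N) i"
proof -
  have "mat_delete N i 0 = delete_row i (erase_first_col N)"
    using assms by (intro eq_matI) (auto simp: mat_delete_def delete_row_def erase_first_col_def)
  then show ?thesis by (simp add: cofactor_def signed_minor_def)
qed

lemma left_kernel_proportional: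
  fixes A :: "'a::comm_ring_1 mat"
  assumes A: "dim_row A = Suc k" "dim_col A = k" and y: "\<And>j. j < k \<Longrightarrow> (\<Sum>i<Suc k. y i * A $$ (i, j)) = 0"
    and l: "l < Suc k" and r: "r < Suc k"
  shows "y l * signed_minor A r = y r * signed_minor A l"
proof -
  \<comment> \<open>With the unit vector \<open>e\<^sub>r\<close> prepended, \<open>y\<^sup>T N = (y\<^sub>r, 0, \<dots>, 0)\<close>; multiply by the adjugate.\<close>
  define N where "N = mat (Suc k) (Suc k) (\<lambda>(i, j). if j = 0 then (if i = r then 1 else 0) else A $$ (i, j - 1))"
  have N: "N \<in> carrier_mat (Suc k) (Suc k)" by (simp add: N_def)
  have "erase_first_col N = A" using A by (intro eq_matI) (auto simp: erase_first_col_def N_def)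
  then have cof: "cofactor N i 0 = signed_minor A i" if "i < Suc k" for i
    using cofactor_first_col[OF N that] by simp
  have N0: "N $$ (i, 0) = (if i = r then 1 else 0)" if "i < Suc k" for i using that by (simp add: N_def)
  have "det N = (\<Sum>i<Suc k. N $$ (i, 0) * cofactor N i 0)" by (rule laplace_expansion_column[OF N]) simp
  also have "\<dots> = (\<Sum>i<Suc k. if i = r then signed_minor A i else 0)"
    by (intro sum.cong refl) (simp add: cof N0)
  also have "\<dots> = signed_minor A r" using r by simp
  finally have detN: "det N = signed_minor A r" .
  have adj: "(\<Sum>j<Suc k. N $$ (i, j) * cofactor N l j) = (if i = l then det N else 0)" if i: "i < Suc k" for i
  proof -
    have "(\<Sum>j<Suc k. N $$ (i, j) * cofactor N l j) = (N * adj_mat N) $$ (i, l)"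
      using N i l by (simp add: scalar_prod_def adj_mat_def lessThan_atLeast0 del: sum.op_ivl_Suc sum.lessThan_Suc)
    then show ?thesis using i l by (simp add: adj_mat(2)[OF N])
  qed
  have yN: "(\<Sum>i<Suc k. y i * N $$ (i, j)) = (if j = 0 then y r else 0)" if "j < Suc k" for j
  proof (cases "j = 0")
    case True
    then have "(\<Sum>i<Suc k. y i * N $$ (i, j)) = (\<Sum>i<Suc k. if i = r then y i else 0)"
      by (intro sum.cong refl) (simp add: N_def)
    then show ?thesis using True r by simp
  next
    case False
    then have "(\<Sum>i<Suc k. y i * N $$ (i, j)) = (\<Sum>i<Suc k. y i * A $$ (i, j - 1))"
      using that by (intro sum.cong refl) (simp add: N_def)
    then show ?thesis using y[of "j - 1"] False that by simp
  qed
  have "y l * det N = (\<Sum>i<Suc k. if i = l then y i * det N else 0)" using l by simp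
  also have "\<dots> = (\<Sum>i<Suc k. y i * (\<Sum>j<Suc k. N $$ (i, j) * cofactor N l j))"
    by (intro sum.cong refl) (simp add: adj del: sum.lessThan_Suc)
  also have "\<dots> = (\<Sum>i<Suc k. \<Sum>j<Suc k. y i * N $$ (i, j) * cofactor N l j)"
    by (simp only: sum_distrib_left mult.assoc)
  also have "\<dots> = (\<Sum>j<Suc k. (\<Sum>i<Suc k. y i * N $$ (i, j)) * cofactor N l j)"
    by (subst sum.swap) (simp only: sum_distrib_right)
  also have "\<dots> = (\<Sum>j<Suc k. if j = 0 then y r * signed_minor A l else 0)"
    by (intro sum.cong refl) (simp add: yN cof[OF l] del: sum.lessThan_Suc)
  also have "\<dots> = y r * signed_minor A l" by simp
  finally show ?thesis by (simp add: detN)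
qed

section \<open>Homogeneous forms and their determinants\<close>

lemma homogX_0: "homogX n 0"
  by (simp add: homogX_def)

lemma homogX_constX: "homogX 0 (constX c)"
  by (simp add: homogX_def coeffX_constX)

lemma homogX_add:
  fixes q r :: "'k::comm_ring_1 xpoly"
  assumes "homogX n q" "homogX n r"
  shows "homogX n (q + r)"
  unfolding homogX_def
proof (intro allI impI)
  fix a b c e assume "coeffX (q + r) a b c e \<noteq> 0"
  then have "coeffX q a b c e \<noteq> 0 \<or> coeffX r a b c e \<noteq> 0" by (auto simp: coeffX_def)
  then show "a + b + c + e = n" using assms unfolding homogX_def by blast
qed

lemma homogX_uminus: "homogX n (q :: 'k::comm_ring_1 xpoly) \<Longrightarrow> homogX n (- q)"
  by (simp add: homogX_def coeffX_def)

lemma homogX_sum: "(\<And>x. x \<in> S \<Longrightarrow> homogX n (f x :: 'k::comm_ring_1 xpoly)) \<Longrightarrow> homogX n (sum f S)"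
  by (induction S rule: infinite_finite_induct) (simp_all add: homogX_0 homogX_add)

lemma homogX_mult:
  fixes q r :: "'k::comm_ring_1 xpoly"
  assumes "homogX m q" "homogX n r"
  shows "homogX (m + n) (q * r)"
  unfolding homogX_def
proof (intro allI impI, rule ccontr)
  fix a b c e assume nz: "coeffX (q * r) a b c e \<noteq> 0" and ne: "a + b + c + e \<noteq> m + n"
  have "coeffX (q * r) a b c e =
      (\<Sum>i\<le>a. \<Sum>j\<le>b. \<Sum>k\<le>c. \<Sum>l\<le>e. coeffX q i j k l * coeffX r (a - i) (b - j) (c - k) (e - l))"
    by (simp only: coeffX_def coeff_mult coeff_sum)
  also have "\<dots> = 0"
  proof (intro sum.neutral ballI)
    fix i j k l assume "i \<in> {..a}" "j \<in> {..b}" "k \<in> {..c}" "l \<in> {..e}"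
    then have "a - i + i = a" "b - j + j = b" "c - k + k = c" "e - l + l = e" by simp_all
    then have "i + j + k + l \<noteq> m \<or> (a - i) + (b - j) + (c - k) + (e - l) \<noteq> n" using ne by linarith
    then have "coeffX q i j k l = 0 \<or> coeffX r (a - i) (b - j) (c - k) (e - l) = 0"
      using assms unfolding homogX_def by blast
    then show "coeffX q i j k l * coeffX r (a - i) (b - j) (c - k) (e - l) = 0" by auto
  qed
  finally show False using nz by simp
qed

lemma homogX_1: "homogX 0 (1 :: 'k::comm_ring_1 xpoly)"
  using homogX_constX[of 1] by (simp add: constX_def one_pCons)

lemma homogX_power: "homogX m (q :: 'k::comm_ring_1 xpoly) \<Longrightarrow> homogX (m * n) (q ^ n)"
proof (induction n)
  case (Suc n)
  then show ?case using homogX_mult[of m q "m * n" "q ^ n"] by simp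
qed (simp add: homogX_1)

lemma homogX_prod:
  "(\<And>x. x \<in> S \<Longrightarrow> homogX (m x) (f x :: 'k::comm_ring_1 xpoly)) \<Longrightarrow> homogX (sum m S) (prod f S)"
proof (induction S rule: infinite_finite_induct)
  case (insert x S)
  then show ?case using homogX_mult[of "m x" "f x" "sum m S" "prod f S"] by simp
qed (simp_all add: homogX_1)

text \<open>Each product in the permutation expansion takes one entry from every column, so degrees
  may vary between columns.\<close>

lemma homogX_det:
  fixes A :: "'k::comm_ring_1 xpoly mat"
  assumes A: "A \<in> carrier_mat n n" and hom: "\<And>i j. i < n \<Longrightarrow> j < n \<Longrightarrow> homogX (e j) (A $$ (i, j))"
  shows "homogX (\<Sum>j<n. e j) (det A)"
  unfolding det_col[OF A]
proof (rule homogX_sum)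
  fix s assume s: "s \<in> {s. s permutes {0..<n}}"
  have "homogX (\<Sum>j<n. e j) (\<Prod>j<n. A $$ (s j, j))"
  proof (rule homogX_prod)
    fix j assume "j \<in> {..<n}"
    then show "homogX (e j) (A $$ (s j, j))" using hom[of "s j" j] permutes_in_image[of s "{0..<n}" j] s by auto
  qed
  then show "homogX (\<Sum>j<n. e j) (of_int (sign s) * (\<Prod>j<n. A $$ (s j, j)))"
    by (cases s rule: sign_cases) (simp_all add: homogX_uminus)
qed

subsection \<open>Inversion\<close>

lemma tmon_eq_monom: "tmon (a, b, c) = monom (monom (monom (1 :: 'k::comm_ring_1) c) b) a"
proof -
  have "t1 ^ a = (monom 1 a :: 'k tpoly)" "t2 ^ b = ([:monom 1 b:] :: 'k tpoly)" "t3 ^ c = ([:[:monom 1 c:]:] :: 'k tpoly)"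
    by (simp_all add: t1_def t2_def t3_def poly_const_pow monom_altdef)
  then show ?thesis
    by (simp add: tmon_def mult_monom smult_monom flip: monom_0)
qed

lemma coeffT_tmon: "coeffT (tmon \<alpha> :: 'k::comm_ring_1 tpoly) a b c = (if \<alpha> = (a, b, c) then 1 else 0)"
  by (cases \<alpha>) (simp add: tmon_eq_monom coeffT_def)

lemma tmon_eq_iff: "tmon \<alpha> = (tmon \<beta> :: 'k::comm_ring_1 tpoly) \<longleftrightarrow> \<alpha> = \<beta>"
proof
  obtain a b c where b: "\<beta> = (a, b, c)" by (cases \<beta>)
  assume "tmon \<alpha> = (tmon \<beta> :: 'k tpoly)"
  then have "coeffT (tmon \<alpha> :: 'k tpoly) a b c = coeffT (tmon \<beta>) a b c" by simp
  then show "\<alpha> = \<beta>" by (simp add: coeffT_tmon b split: if_splits)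
qed simp

lemma tmon_nonzero: "tmon \<alpha> \<noteq> (0 :: 'k::comm_ring_1 tpoly)"
  by (cases \<alpha>) (simp add: tmon_eq_monom)

lemma var_mult_tmon:
  "t1 * tmon (a, b, c) = tmon (Suc a, b, c)" "t2 * tmon (a, b, c) = tmon (a, Suc b, c)"
  "t3 * tmon (a, b, c) = tmon (a, b, Suc c)"
  by (simp_all add: tmon_def ac_simps)

text \<open>The defining identities are stated over the rationals; they only compare exponents, and
  so transfer to any coefficient ring.\<close>

lemma good_monomialsE:
  assumes "good_monomials m d \<alpha>"
  obtains j1 j2 j3 where "j1 < d" "j2 < d" "j3 < d"
    "(t1 :: 'k::comm_ring_1 tpoly) * tmon (\<alpha> j3) = t3 * tmon (\<alpha> j1)"
    "(t2 :: 'k tpoly) * tmon (\<alpha> j3) = t3 * tmon (\<alpha> j2)"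
proof -
  have *: "(t1 :: 'k tpoly) * tmon \<beta> = t3 * tmon \<gamma>" if "(t1 :: rat tpoly) * tmon \<beta> = t3 * tmon \<gamma>" for \<beta> \<gamma>
    using that by (cases \<beta>; cases \<gamma>) (simp add: var_mult_tmon tmon_eq_iff)
  have "(t2 :: 'k tpoly) * tmon \<beta> = t3 * tmon \<gamma>" if "(t2 :: rat tpoly) * tmon \<beta> = t3 * tmon \<gamma>" for \<beta> \<gamma>
    using that by (cases \<beta>; cases \<gamma>) (simp add: var_mult_tmon tmon_eq_iff)
  with * show thesis using assms that unfolding good_monomials_def by metis
qed

lemma tpoly_as_sum:
  fixes q :: "'k::comm_ring_1 tpoly"
  shows "q = (\<Sum>(i, j, k)\<in>{(i, j, k). coeffT q i j k \<noteq> 0}. constT (coeffT q i j k) * tmon (i, j, k))"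
    (is "q = (\<Sum>(i, j, k)\<in>?S. _)")
proof -
  have mult: "coeffT (constT x * r) a b c = x * coeffT r a b c" for x :: 'k and r a b c
    by (simp add: constT_def coeffT_def)
  have "coeffT (\<Sum>(i, j, k)\<in>?S. constT (coeffT q i j k) * tmon (i, j, k)) a b c = coeffT q a b c" for a b c
  proof -
    have "coeffT (\<Sum>(i, j, k)\<in>?S. constT (coeffT q i j k) * tmon (i, j, k)) a b c =
        (\<Sum>s\<in>?S. coeffT (case s of (i, j, k) \<Rightarrow> constT (coeffT q i j k) * tmon (i, j, k)) a b c)"
      by (simp add: coeffT_def coeff_sum)
    also have "\<dots> = (\<Sum>s\<in>?S. if s = (a, b, c) then coeffT q a b c else 0)"
      by (intro sum.cong refl) (auto simp: mult coeffT_tmon split: if_splits)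
    also have "\<dots> = coeffT q a b c" by (simp add: finite_supportT)
    finally show ?thesis .
  qed
  then show ?thesis unfolding tpoly_eq_iff by metis
qed

text \<open>The forms \<open>f\<close>, \<open>h\<close>, \<open>g\<close> represent t1 : t2 : t3 on
  the surface, and the witness is \<open>a\<close> with these forms substituted for the
  variables.\<close>

lemma homogT_pullback:
  fixes p :: "nat \<Rightarrow> 'k::comm_ring_1 tpoly"
  assumes fgh: "homogX e f" "homogX e g" "homogX e h"
    and t1: "t1 * evalX p g = t3 * evalX p f" and t2: "t2 * evalX p g = t3 * evalX p h"
    and a: "homogT n a"
  shows "\<exists>A. homogX (e * n) A \<and> a * evalX p g ^ n = t3 ^ n * evalX p A"
proof (intro exI conjI)
  interpret ev: comm_ring_hom "evalX p" by (rule comm_ring_hom_evalX)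
  let ?S = "{(i, j, k). coeffT a i j k \<noteq> 0}"
  let ?A = "\<Sum>(i, j, k)\<in>?S. constX (coeffT a i j k) * (f ^ i * h ^ j * g ^ k)"
  have deg: "i + j + k = n" if "(i, j, k) \<in> ?S" for i j k using a that unfolding homogT_def by blast
  show "homogX (e * n) ?A"
  proof (rule homogX_sum)
    fix s assume s: "s \<in> ?S"
    obtain i j k where ijk: "s = (i, j, k)" by (cases s)
    have "homogX (0 + (e * i + e * j + e * k)) (constX (coeffT a i j k) * (f ^ i * h ^ j * g ^ k))"
      by (intro homogX_mult homogX_constX homogX_power fgh)
    moreover have "0 + (e * i + e * j + e * k) = e * n"
      using deg s ijk by (simp add: add_mult_distrib2[symmetric])
    ultimately show "homogX (e * n) (case s of (i, j, k) \<Rightarrow> constX (coeffT a i j k) * (f ^ i * h ^ j * g ^ k))"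
      by (simp add: ijk)
  qed
  have mon: "tmon (i, j, k) * evalX p g ^ n = t3 ^ n * evalX p (f ^ i * h ^ j * g ^ k)" if "i + j + k = n" for i j k
  proof -
    have "tmon (i, j, k) * evalX p g ^ n = (t1 * evalX p g) ^ i * (t2 * evalX p g) ^ j * (t3 * evalX p g) ^ k"
      unfolding that[symmetric] by (simp add: tmon_def power_add power_mult_distrib ac_simps)
    also have "\<dots> = t3 ^ n * (evalX p f ^ i * evalX p h ^ j * evalX p g ^ k)"
      unfolding t1 t2 that[symmetric] by (simp add: power_add power_mult_distrib ac_simps)
    finally show ?thesis by (simp add: ev.hom_mult ev.hom_power)
  qed
  have const: "evalX p (constX c) = constT c" for c
    by (simp add: evalX_eq_substX substX_constX comm_ring_hom_constT)
  have "a * evalX p g ^ n = (\<Sum>(i, j, k)\<in>?S. constT (coeffT a i j k) * tmon (i, j, k)) * evalX p g ^ n"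
    using tpoly_as_sum[of a] by simp
  also have "\<dots> = (\<Sum>(i, j, k)\<in>?S. constT (coeffT a i j k) * (tmon (i, j, k) * evalX p g ^ n))"
    by (simp add: sum_distrib_right split_def mult.assoc)
  also have "\<dots> = (\<Sum>(i, j, k)\<in>?S. t3 ^ n * evalX p (constX (coeffT a i j k) * (f ^ i * h ^ j * g ^ k)))"
  proof (rule sum.cong[OF refl])
    fix s assume "s \<in> ?S"
    then show "(case s of (i, j, k) \<Rightarrow> constT (coeffT a i j k) * (tmon (i, j, k) * evalX p g ^ n)) =
        (case s of (i, j, k) \<Rightarrow> t3 ^ n * evalX p (constX (coeffT a i j k) * (f ^ i * h ^ j * g ^ k)))"
      using deg mon by (cases s) (simp add: ev.hom_mult[of "constX _"] const mult.left_commute)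
  qed
  also have "\<dots> = t3 ^ n * evalX p ?A"
    by (simp add: ev.hom_sum sum_distrib_left split_def)
  finally show "a * evalX p g ^ n = t3 ^ n * evalX p ?A" .
qed

text \<open>Inverting the affine coordinates t1/t3 and t2/t3 suffices: the pullbacks of
  \<open>a\<close> and \<open>b\<close> carry the same factors, which cancel in the
  quotient.\<close>

lemma birationalI:
  fixes p :: "nat \<Rightarrow> 'k::idom tpoly"
  assumes fgh: "homogX e f" "homogX e g" "homogX e h" and g: "evalX p g \<noteq> 0"
    and t: "t1 * evalX p g = t3 * evalX p f" "t2 * evalX p g = t3 * evalX p h"
  shows "birational p"
  unfolding birational_def
proof (intro allI impI)
  fix a b :: "'k tpoly" and n assume ab: "homogT n a \<and> homogT n b \<and> b \<noteq> 0"
  obtain A where A: "homogX (e * n) A" "a * evalX p g ^ n = t3 ^ n * evalX p A"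
    using homogT_pullback[OF fgh t] ab by blast
  obtain B where B: "homogX (e * n) B" "b * evalX p g ^ n = t3 ^ n * evalX p B"
    using homogT_pullback[OF fgh t] ab by blast
  have "evalX p B \<noteq> 0" using B(2) ab g by auto
  moreover have "evalX p g ^ n * t3 ^ n * (a * evalX p B) = evalX p g ^ n * t3 ^ n * (b * evalX p A)"
  proof -
    have "evalX p g ^ n * t3 ^ n * (a * evalX p B) = (a * evalX p g ^ n) * (t3 ^ n * evalX p B)" by (simp add: ac_simps)
    also have "\<dots> = evalX p g ^ n * t3 ^ n * (b * evalX p A)" unfolding A(2) B(2)[symmetric] by (simp add: ac_simps)
    finally show ?thesis .
  qed
  then have "a * evalX p B = b * evalX p A" using g by (simp add: t_nonzero)
  ultimately show "\<exists>f g e. homogX e f \<and> homogX e g \<and> evalX p g \<noteq> 0 \<and> a * evalX p g = b * evalX p f"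
    using A(1) B(1) by blast
qed

lemma evalX_signed_minor: "evalX p (signed_minor A r) = signed_minor (map_mat (evalX p) A) r"
  if "r < dim_row A"
proof -
  interpret ev: comm_ring_hom "evalX p" by (rule comm_ring_hom_evalX)
  have "delete_row r (map_mat (evalX p) A) = map_mat (evalX p) (delete_row r A)"
    using that by (intro eq_matI) (auto simp: delete_row_def)
  then show ?thesis by (simp add: signed_minor_def ev.hom_mult ev.hom_power ev.hom_uminus ev.hom_det)
qed

lemma homogX_signed_minor:
  fixes A :: "'k::comm_ring_1 xpoly mat"
  assumes A: "dim_row A = Suc k" "dim_col A = k"
    and hom: "\<And>i j. i < Suc k \<Longrightarrow> j < k \<Longrightarrow> homogX (e j) (A $$ (i, j))"
  shows "homogX (\<Sum>j<k. e j) (signed_minor A r)"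
proof -
  have "homogX (\<Sum>j<k. e j) (det (delete_row r A))"
    by (rule homogX_det) (auto simp: delete_row_def A intro!: hom)
  then show ?thesis by (cases "even r") (simp_all add: signed_minor_def homogX_uminus)
qed

lemma inversion_matrix_imp_birational:
  fixes p :: "nat \<Rightarrow> 'k::{idom, ring_char_0} tpoly"
  assumes p: "param p" "generically_finite p" and F: "prime_elem F" "evalX p F = 0"
    and inv: "inversion_matrix p F A"
  shows "birational p"
proof -
  obtain d m \<alpha> where A: "dim_row A = d" "dim_col A = d - 1" and good: "good_monomials m d \<alpha>"
      and mov: "\<And>i. i < d - 1 \<Longrightarrow> \<exists>e. moving_col p m d \<alpha> A i e" and rank: "full_col_rank_mod F A"
    using inv unfolding inversion_matrix_def by blast
  obtain j1 j2 j3 where j: "j1 < d" "j2 < d" "j3 < d"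
      and t: "(t1 :: 'k tpoly) * tmon (\<alpha> j3) = t3 * tmon (\<alpha> j1)" "(t2 :: 'k tpoly) * tmon (\<alpha> j3) = t3 * tmon (\<alpha> j2)"
    using good_monomialsE[OF good] by blast
  define k where "k = d - 1"
  have d: "d = Suc k" using j(1) by (simp add: k_def)
  have dims: "dim_row A = Suc k" "dim_col A = k" using A d by simp_all
  obtain e where e: "\<And>i. i < k \<Longrightarrow> moving_col p m d \<alpha> A i (e i)" using mov unfolding k_def by metis
  \<comment> \<open>The columns may have different degrees, but every maximal minor has their sum as
    its degree, so minors can serve as numerators and denominators.\<close>
  define E where "E = (\<Sum>j<k. e j)"
  have hom: "homogX E (signed_minor A r)" for r
    unfolding E_def by (rule homogX_signed_minor[OF dims]) (use e d in \<open>auto simp: moving_col_def\<close>)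
  define v where "v r = evalX p (signed_minor A r)" for r
  define y :: "nat \<Rightarrow> 'k tpoly" where "y r = tmon (\<alpha> r)" for r
  have y: "y r \<noteq> 0" for r by (simp add: y_def tmon_nonzero)
  have minors: "y l * v r = y r * v l" if "l < d" "r < d" for l r
  proof -
    have "(\<Sum>i<Suc k. y i * map_mat (evalX p) A $$ (i, j)) = 0" if "j < k" for j
    proof -
      have "(\<Sum>i<Suc k. y i * map_mat (evalX p) A $$ (i, j)) = (\<Sum>i<d. evalX p (A $$ (i, j)) * tmon (\<alpha> i))"
        unfolding d using that dims by (intro sum.cong refl) (simp add: y_def mult.commute)
      then show ?thesis using e[OF that] by (simp add: moving_col_def)
    qed
    then show ?thesis
      using left_kernel_proportional[of "map_mat (evalX p) A" k y l r] that dims d by (simp add: v_def evalX_signed_minor)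
  qed
  have "\<not> F dvd 1" using F(1) by (simp add: prime_elem_def)
  then obtain r where r: "r < d" "\<not> F dvd det (delete_row r A)"
    using ex_maximal_minor_not_dvd[OF _ dims rank] d by blast
  have "\<not> F dvd signed_minor A r"
    using r(2) by (cases "even r") (simp_all add: signed_minor_def)
  then have "v r \<noteq> 0" using evalX_kernel[OF p F] unfolding v_def by blast
  \<comment> \<open>Proportionality to the nonzero monomials carries nonvanishing from one minor to
    all of them.\<close>
  then have v3: "v j3 \<noteq> 0" using minors[OF j(3) r(1)] y[of j3] by auto
  have ratio: "x * v j3 = t3 * v i" if i: "i < d" and x: "x * y j3 = t3 * y i" for x i
  proof -
    have "y j3 * (x * v j3) = (x * y j3) * v j3" by (simp only: ac_simps)
    also have "\<dots> = t3 * (y i * v j3)" by (simp only: x mult.assoc)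
    also have "\<dots> = y j3 * (t3 * v i)" by (simp only: minors[OF i j(3)] mult.left_commute)
    finally show ?thesis using y[of j3] by simp
  qed
  have "t1 * v j3 = t3 * v j1" "t2 * v j3 = t3 * v j2"
    by (rule ratio; use j t in \<open>simp add: y_def\<close>)+
  then show ?thesis using birationalI[OF hom hom hom, of p j3 j1 j2] v3 unfolding v_def by blast
qed

subsection \<open>Implicitization matrices\<close>

text \<open>One factor \<open>F\<close> is cancelled at a time, from \<open>g\<close> or from its
  cofactor.\<close>

lemma dvd_prime_elem_power:
  fixes F :: "'a::idom"
  assumes F: "prime_elem F" and "g dvd F ^ n"
  shows "\<exists>q u. u dvd 1 \<and> g = u * F ^ q"
  using assms(2)
proof (induction n arbitrary: g)
  case 0
  then show ?case by (intro exI[of _ 0] exI[of _ g]) simp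
next
  case (Suc n)
  have "F \<noteq> 0" using F by auto
  obtain h where h: "F * F ^ n = g * h" using Suc.prems by (auto elim: dvdE)
  then have "F dvd g * h" by (metis dvd_triv_left)
  then consider "F dvd g" | "F dvd h" using F by (auto simp: prime_elem_dvd_mult_iff)
  then show ?case
  proof cases
    case 1
    then obtain g' where g': "g = F * g'" by blast
    then have "F ^ n = g' * h" using h \<open>F \<noteq> 0\<close> by (simp add: mult.assoc)
    then obtain q u where "u dvd 1" "g' = u * F ^ q" using Suc.IH[of g'] by auto
    then show ?thesis using g' by (intro exI[of _ "Suc q"] exI[of _ u]) simp
  next
    case 2
    then obtain h' where "h = F * h'" by blast
    then have "F ^ n = g * h'" using h \<open>F \<noteq> 0\<close> by (simp add: mult.left_commute)
    then show ?thesis using Suc.IH[of g] by simp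
  qed
qed

lemma unit_xpolyE:
  fixes u :: "'k::field xpoly"
  assumes "u dvd 1"
  obtains c where "c \<noteq> 0" "u = constX c"
proof -
  obtain c where "u = constX c" "c dvd 1" using assms by (auto simp: is_unit_poly_iff constX_def)
  moreover from this have "c \<noteq> 0" by (metis dvd_0_left zero_neq_one)
  ultimately show thesis using that by blast
qed

text \<open>Multiplying a dependence modulo \<open>F\<close> by the adjugate of the minor shows that
  \<open>F\<close> divides the minor times each coefficient; primality then leaves the
  coefficient.\<close>

lemma full_col_rank_modI:
  fixes A :: "'k::idom xpoly mat"
  assumes F: "prime_elem F" and A: "dim_row A = Suc k" "dim_col A = k"
    and r: "r < Suc k" "\<not> F dvd det (delete_row r A)"
  shows "full_col_rank_mod F A"
  unfolding full_col_rank_mod_def A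
proof (intro allI impI)
  fix c l assume c: "\<forall>i<Suc k. F dvd (\<Sum>j<k. c j * A $$ (i, j))" and l: "l < k"
  define B where "B = delete_row r A"
  have B: "B \<in> carrier_mat k k" by (simp add: B_def delete_row_def A)
  have row: "F dvd (\<Sum>j<k. B $$ (i, j) * c j)" if "i < k" for i
  proof -
    have "(\<Sum>j<k. B $$ (i, j) * c j) = (\<Sum>j<k. c j * A $$ (if i < r then i else Suc i, j))"
      using that by (intro sum.cong refl) (simp add: B_def delete_row_def A mult.commute)
    then show ?thesis using c that by simp
  qed
  have adj: "(\<Sum>i<k. adj_mat B $$ (l, i) * B $$ (i, j)) = (if j = l then det B else 0)" if j: "j < k" for j
  proof -
    have "(\<Sum>i<k. adj_mat B $$ (l, i) * B $$ (i, j)) = (adj_mat B * B) $$ (l, j)"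
      using B adj_mat(1)[OF B] l j by (simp add: scalar_prod_def lessThan_atLeast0)
    then show ?thesis using l j by (auto simp: adj_mat(3)[OF B])
  qed
  have "det B * c l = (\<Sum>j<k. if j = l then det B * c j else 0)" using l by simp
  also have "\<dots> = (\<Sum>j<k. (\<Sum>i<k. adj_mat B $$ (l, i) * B $$ (i, j)) * c j)"
    by (intro sum.cong refl) (simp add: adj)
  also have "\<dots> = (\<Sum>j<k. \<Sum>i<k. adj_mat B $$ (l, i) * (B $$ (i, j) * c j))"
    by (simp only: sum_distrib_right mult.assoc)
  also have "\<dots> = (\<Sum>i<k. adj_mat B $$ (l, i) * (\<Sum>j<k. B $$ (i, j) * c j))"
    by (subst sum.swap) (simp only: sum_distrib_left)
  finally have "F dvd det B * c l" using row by (auto intro!: dvd_sum)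
  then show "F dvd c l" using F r(2) by (auto simp: prime_elem_dvd_mult_iff B_def)
qed

theorem theorem4p2:
  fixes p :: "nat \<Rightarrow> 'k::{field_char_0, field_gcd} tpoly"
    and F :: "'k xpoly"
    and M :: "'k xpoly mat"
  assumes "param p"
    and "generically_finite p"
    and "implicit_eq p F"
    and "implicitization_matrix p F M"
  shows "\<exists>q::nat. (\<exists>c. c \<noteq> 0 \<and> Gcd (maximal_minors (erase_first_col M)) = constX c * F ^ q) \<and>
           (birational p \<longleftrightarrow> q = 0) \<and>
           (birational p \<longleftrightarrow> inversion_matrix p F (erase_first_col M))"
proof -
  define A where "A = erase_first_col M"
  define g where "g = Gcd (maximal_minors A)"
  have F: "prime_elem F" "evalX p F = 0"
    using assms(3) irreducible_imp_prime_elem unfolding implicit_eq_def by blast+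
  have "F \<noteq> 0" using F(1) by auto
  obtain d m \<alpha> where dimM: "dim_row M = d" "dim_col M = d" and m: "m \<ge> 1" and good: "good_monomials m d \<alpha>"
      and P: "\<exists>e0 \<ge> 1. \<forall>j<d. homogX e0 (M $$ (j, 0))"
      and mov: "\<forall>i. 1 \<le> i \<and> i < d \<longrightarrow> (\<exists>e. moving_col p m d \<alpha> M i e)"
      and D: "\<exists>\<delta> c. \<delta> \<ge> 1 \<and> c \<noteq> 0 \<and> det M = constX c * F ^ \<delta> \<and> (birational p \<longrightarrow> \<delta> = 1)"
    using assms(4) unfolding implicitization_matrix_def by metis
  obtain \<delta> c where c: "c \<noteq> 0" "det M = constX c * F ^ \<delta>" "birational p \<longrightarrow> \<delta> = 1" using D by blast
  define k where "k = d - 1"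
  \<comment> \<open>The distinguished monomials supply an index below \<open>d\<close>, so
    \<open>d\<close> is positive.\<close>
  have d: "d = Suc k" using good unfolding good_monomials_def k_def by force
  have M: "M \<in> carrier_mat (Suc k) (Suc k)" using dimM d by auto
  have dimA: "dim_row A = Suc k" "dim_col A = k" using dimM d by (simp_all add: A_def erase_first_col_def)
  have detM: "det M = (\<Sum>i<Suc k. M $$ (i, 0) * signed_minor A i)"
    using laplace_expansion_column[OF M, of 0] cofactor_first_col[OF M] by (simp add: A_def del: sum.lessThan_Suc)
  have g_dvd: "g dvd signed_minor A i" if "i < Suc k" for i
    unfolding g_def signed_minor_def by (intro dvd_mult Gcd_dvd) (use that dimA in \<open>auto simp: maximal_minors_def\<close>)
  have "g dvd constX c * F ^ \<delta>"
    unfolding c(2)[symmetric] detM using g_dvd by (auto intro!: dvd_sum simp del: sum.lessThan_Suc)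
  moreover have "F ^ \<delta> = constX (inverse c) * (constX c * F ^ \<delta>)" using c(1) by (simp add: constX_def flip: one_pCons)
  ultimately have "g dvd F ^ \<delta>" by (metis dvd_mult)
  then obtain q u where "u dvd 1" and g: "g = u * F ^ q" using dvd_prime_elem_power[OF F(1)] by blast
  then obtain c' where c': "c' \<noteq> 0" "u = constX c'" using unit_xpolyE by blast
  have q0: "q = 0" if "birational p"
  proof (rule ccontr)
    assume "q \<noteq> 0"
    then have "F dvd g" unfolding g by (simp add: dvd_power)
    then have "\<exists>w. signed_minor A i = F * w" if "i < Suc k" for i
      using g_dvd[OF that] by (meson dvd_def dvd_trans)
    then obtain w where w: "\<And>i. i < Suc k \<Longrightarrow> signed_minor A i = F * w i" by metis
    \<comment> \<open>Here the exponent of \<open>F\<close> in \<open>det M\<close> is 1, and the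
      factor \<open>F\<close> common to all minors cancels.\<close>
    have "F * constX c = F * (\<Sum>i<Suc k. M $$ (i, 0) * w i)"
      using c(2,3) that unfolding detM sum_distrib_left
      by (simp add: w mult.left_commute mult.commute[of "constX c"] del: sum.lessThan_Suc)
    then have "constX c = (\<Sum>i<Suc k. M $$ (i, 0) * w i)" using \<open>F \<noteq> 0\<close> mult_left_cancel by blast
    \<comment> \<open>Constant terms are compared: the entries of the first column are homogeneous
      of positive degree and contribute nothing.\<close>
    then have "coeffX (constX c) 0 0 0 0 = coeffX (\<Sum>i<Suc k. M $$ (i, 0) * w i) 0 0 0 0" by simp
    also have "\<dots> = (\<Sum>i<Suc k. coeffX (M $$ (i, 0)) 0 0 0 0 * coeffX (w i) 0 0 0 0)"
      by (simp add: coeffX_def coeff_sum coeff_mult_0 del: sum.lessThan_Suc)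
    also have "\<dots> = 0"
    proof (intro sum.neutral ballI)
      fix i assume "i \<in> {..<Suc k}"
      then have "coeffX (M $$ (i, 0)) 0 0 0 0 = 0" using P d unfolding homogX_def by fastforce
      then show "coeffX (M $$ (i, 0)) 0 0 0 0 * coeffX (w i) 0 0 0 0 = 0" by simp
    qed
    finally show False using c(1) by (simp add: coeffX_constX)
  qed
  have inv: "inversion_matrix p F A" if "q = 0"
  proof -
    \<comment> \<open>For \<open>q = 0\<close> the gcd is a unit, so the prime \<open>F\<close>
      cannot divide every minor.\<close>
    have "\<not> F dvd g" using F(1) that \<open>u dvd 1\<close> g by (metis dvd_trans mult.right_neutral power_0 prime_elem_def)
    then obtain r where "r < Suc k" "\<not> F dvd det (delete_row r A)"
      unfolding g_def maximal_minors_def dimA by (auto intro: Gcd_greatest)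
    then have "full_col_rank_mod F A" using full_col_rank_modI[OF F(1) dimA] by blast
    moreover have "\<exists>e. moving_col p m d \<alpha> A i e" if i: "i < d - 1" for i
    proof -
      have "1 \<le> Suc i \<and> Suc i < d" using i by simp
      then obtain e where e: "moving_col p m d \<alpha> M (Suc i) e" using mov by blast
      have "A $$ (j, i) = M $$ (j, Suc i)" if "j < d" for j
        using that i dimM by (simp add: A_def erase_first_col_def)
      then have "moving_col p m d \<alpha> A i e" using e by (simp add: moving_col_def)
      then show ?thesis by blast
    qed
    ultimately show ?thesis unfolding inversion_matrix_def using dimA d m good by fastforce
  qed
  have bir: "birational p" if "inversion_matrix p F A"
    using inversion_matrix_imp_birational[OF assms(1,2) F that] .
  \<comment> \<open>The equivalences close in a cycle: birationality gives \<open>q = 0\<close>,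
    this gives an inversion matrix, and that gives birationality.\<close>
  show ?thesis
    using c' g q0 inv bir unfolding g_def A_def by blast
qed

end
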